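(* Let $K\subset\mathbb{R}^n$ be a convex body, write its support function as $h_K=h_{\mathrm{even}}+h_{\mathrm{odd}}$ (even and odd parts), and set $$I_{2r}=V\left(h_{\mathrm{even}}^{[n-2r]},h_{\mathrm{odd}}^{[2r]}\right),\qquad r=0,\ldots,\left\lfloor\frac n2\right\rfloor.$$ For $j=0,\ldots,n$ define $G_j(K)=V\left((-K)^{[j]},K^{[n-j]}\right)$ and the binary Krawtchouk polynomial $$\mathrm{Kr}_m(j;n)=\sum_{\ell=0}^{m}(-1)^\ell\binom{j}{\ell}\binom{n-j}{m-\ell},$$ where binomial coefficients outside their natural range are zero. Then for every $j=0,\ldots,n$, $$G_j(K)=\sum_{r=0}^{\lfloor n/2\rfloor}\mathrm{Kr}_{2r}(j;n)\,I_{2r}.$$ Conversely, for every $r=0,\ldots,\lfloor n/2\rfloor$, $$I_{2r}=\frac{1}{2^n\binom{n}{2r}}\sum_{j=0}^{n}\binom{n}{j}\mathrm{Kr}_{2r}(j;n)\,G_j(K).$$ Along the path $K_t=\frac{1+t}{2}K+\frac{1-t}{2}(-K)$, $t\in[-1,1]$, the volume polynomial has the two representations $$\mathrm{Vol}_n(K_t)=\sum_{r=0}^{\lfloor n/2\rfloor}\binom{n}{2r}t^{2r}I_{2r}=2^{-n}\sum_{j=0}^{n}\binom{n}{j}(1+t)^{n-j}(1-t)^jG_j(K).$$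
   Context: A convex body in $\mathbb{R}^n$ is a compact convex set with non-empty interior; $h_K(u)=\max_{x\in K}\langle x,u\rangle$, $u\in\mathbb{S}^{n-1}$, and $h_{\mathrm{even}}(u)=\frac{h_K(u)+h_K(-u)}2$, $h_{\mathrm{odd}}(u)=\frac{h_K(u)-h_K(-u)}2$. $V(K_1,\ldots,K_n)$ is the mixed volume, normalized by $V(K,\ldots,K)=\mathrm{Vol}_n(K)$; a superscript $[r]$ means that the argument is repeated $r$ times. Identifying bodies with their support functions, mixed volume is extended multilinearly to linear combinations (formal differences) of support functions on $\mathbb{S}^{n-1}$. *)

theory Defs
  imports "HOL-Analysis.Analysis"
begin

definition convex_body :: "(real^'n) set \<Rightarrow> bool" where
  "convex_body K \<longleftrightarrow> compact K \<and> convex K \<and> interior K \<noteq> {}"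

definition support_fn :: "(real^'n) set \<Rightarrow> real^'n \<Rightarrow> real" where
  "support_fn K u = (SUP x\<in>K. x \<bullet> u)"

definition even_part :: "(real^'n) set \<Rightarrow> real^'n \<Rightarrow> real" where
  "even_part K u = (support_fn K u + support_fn K (- u)) / 2"

definition odd_part :: "(real^'n) set \<Rightarrow> real^'n \<Rightarrow> real" where
  "odd_part K u = (support_fn K u - support_fn K (- u)) / 2"

text \<open>Minkowski's theorem: there is a symmetric function \<open>V\<close> of \<open>n\<close> convex bodies such that, for
  all convex bodies \<open>K\<^sub>0, \<dots>, K\<^sub>m\<^sub>-\<^sub>1\<close> and \<open>c\<^sub>i \<ge> 0\<close>,
  the volume of \<open>c\<^sub>0 K\<^sub>0 + \<dots> + c\<^sub>m\<^sub>-\<^sub>1 K\<^sub>m\<^sub>-\<^sub>1\<close> is the sum of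
  \<open>c\<^sub>i\<^sub>1 \<cdots> c\<^sub>i\<^sub>n V (K\<^sub>i\<^sub>1, \<dots>, K\<^sub>i\<^sub>n)\<close> over all index tuples.
  These conditions determine \<open>V\<close> on \<open>n\<close>-tuples of convex bodies; \<open>m = 1\<close>, \<open>c\<^sub>0 = 1\<close> is the
  normalization \<open>V (K, \<dots>, K) = Vol K\<close>. Tuples are lists of length \<open>n = CARD('n)\<close>, and sums of
  sets are Minkowski sums.\<close>

definition is_mixed_volume :: "((real^'n) set list \<Rightarrow> real) \<Rightarrow> bool" where
  "is_mixed_volume V \<longleftrightarrow>
     (\<forall>Ks Ls. length Ks = CARD('n) \<and> (\<forall>K\<in>set Ks. convex_body K) \<and> mset Ls = mset Ks
        \<longrightarrow> V Ls = V Ks) \<and>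
     (\<forall>Ks c. (\<forall>K\<in>set Ks. convex_body K) \<and> (\<forall>i<length Ks. 0 \<le> c i)
        \<longrightarrow> measure lebesgue (\<Sum>i<length Ks. (*\<^sub>R) (c i) ` (Ks ! i)) =
            (\<Sum>is | set is \<subseteq> {..<length Ks} \<and> length is = CARD('n).
               (\<Prod>i\<leftarrow>is. c i) * V (map ((!) Ks) is)))"

definition mixed_volume :: "(real^'n) set list \<Rightarrow> real" where
  "mixed_volume Ks = (THE v. \<exists>V. is_mixed_volume V \<and> V Ks = v)"

text \<open>The functions whose restriction to the unit sphere is a linear combination of support functions
  of convex bodies; their values off the sphere are irrelevant.\<close>

definition support_span :: "(real^'n \<Rightarrow> real) set" where
  "support_span = {f. \<exists>(m::nat) c A. (\<forall>i<m. convex_body (A i)) \<and>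
     (\<forall>u\<in>sphere 0 1. f u = (\<Sum>i<m. c i * support_fn (A i) u))}"

text \<open>The multilinear extension of the mixed volume from support functions to their linear span.
  As the linearity condition compares functions on the unit sphere only, \<open>W\<close> depends only on the
  restrictions of its arguments to the sphere (take \<open>a = 1\<close>, \<open>b = 0\<close>).\<close>

definition is_multilinear_extension :: "((real^'n \<Rightarrow> real) list \<Rightarrow> real) \<Rightarrow> bool" where
  "is_multilinear_extension W \<longleftrightarrow>
     (\<forall>Ks. length Ks = CARD('n) \<and> (\<forall>K\<in>set Ks. convex_body K)
        \<longrightarrow> W (map support_fn Ks) = mixed_volume Ks) \<and>
     (\<forall>fs gs p q h a b.
        length fs + length gs + 1 = CARD('n) \<and> set fs \<union> set gs \<union> {p, q, h} \<subseteq> support_span \<and>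
        (\<forall>u\<in>sphere 0 1. h u = a * p u + b * q u)
        \<longrightarrow> W (fs @ h # gs) = a * W (fs @ p # gs) + b * W (fs @ q # gs))"

definition mixed_volume_fn :: "(real^'n \<Rightarrow> real) list \<Rightarrow> real" where
  "mixed_volume_fn fs = (THE v. \<exists>W. is_multilinear_extension W \<and> W fs = v)"

definition I_even :: "(real^'n) set \<Rightarrow> nat \<Rightarrow> real" where
  "I_even K r = mixed_volume_fn
     (replicate (CARD('n) - 2 * r) (even_part K) @ replicate (2 * r) (odd_part K))"

definition G_mixed :: "(real^'n) set \<Rightarrow> nat \<Rightarrow> real" where
  "G_mixed K j = mixed_volume (replicate j (uminus ` K) @ replicate (CARD('n) - j) K)"

text \<open>\<open>krawtchouk m j n\<close> is the polynomial of degree \<open>m\<close> evaluated at \<open>j\<close>, for \<open>j \<le> n\<close>.\<close>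

definition krawtchouk :: "nat \<Rightarrow> nat \<Rightarrow> nat \<Rightarrow> real" where
  "krawtchouk m j n = (\<Sum>l\<le>m. (-1) ^ l * real (j choose l) * real ((n - j) choose (m - l)))"

definition body_path :: "(real^'n) set \<Rightarrow> real \<Rightarrow> (real^'n) set" where
  "body_path K t = (*\<^sub>R) ((1 + t) / 2) ` K + (*\<^sub>R) ((1 - t) / 2) ` (uminus ` K)"

end

theory Submission
  imports Defs "HOL-Combinatorics.List_Permutation" "HOL-Combinatorics.Multiset_Permutations"
    "HOL-Computational_Algebra.Polynomial"
begin

text \<open>The mixed volume has to be constructed, that is, Minkowski's theorem has to be proved. Following
  Gromov, the logarithmic Laplace transform \<open>\<Phi>\<^sub>K x = ln (\<integral>\<^sub>K exp (x \<bullet> y) dy)\<close> of a convex body \<open>K\<close>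
  has positive definite Hessian and its gradient maps space bijectively onto the interior of \<open>K\<close>.
  The gradient of \<open>c\<^sub>1 \<Phi>\<^sub>K\<^sub>1 + \<dots> + c\<^sub>m \<Phi>\<^sub>K\<^sub>m\<close> likewise maps onto the interior of the Minkowski
  combination of the bodies, so the volume of the latter is the integral of
  \<open>det (c\<^sub>1 H\<^sub>1 + \<dots> + c\<^sub>m H\<^sub>m)\<close>, and mixed volumes are integrals of mixed discriminants of Hessians:
  symmetric and multilinear. Bodies with equal support functions coincide, so this extends to
  differences of support functions.

  Expanding the products of \<open>h\<^sub>e\<^sub>v\<^sub>e\<^sub>n = (h\<^sub>K + h\<^sub>-\<^sub>K) / 2\<close> and \<open>h\<^sub>o\<^sub>d\<^sub>d = (h\<^sub>K - h\<^sub>-\<^sub>K) / 2\<close> gives the mixed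
  volume of \<open>n - k\<close> even and \<open>k\<close> odd parts as \<open>2\<^sup>-\<^sup>n\<close> times the sum of \<open>Kr\<^sub>j(k; n) G\<^sub>j\<close>. It vanishes for
  odd \<open>k\<close> since \<open>G\<^sub>j = G\<^sub>n\<^sub>-\<^sub>j\<close>. The rest is orthogonality and symmetry of the Krawtchouk polynomials,
  both read off from the generating function \<open>(1 - z)\<^sup>j (1 + z)\<^sup>n\<^sup>-\<^sup>j\<close>.\<close>

section \<open>Potentials whose gradient fills a convex body\<close>

text \<open>Supplies the quadratic remainder with which Laplace integrals are differentiated under
  the integral sign.\<close>

lemma exp_remainder_le_square:
  fixes s :: real
  assumes "\<bar>s\<bar> \<le> 1"
  shows "\<bar>exp s - 1 - s\<bar> \<le> s\<^sup>2"
proof -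
  have "exp s \<le> 1 + s + s\<^sup>2"
  proof (cases "s \<ge> 0")
    case True
    then show ?thesis using assms exp_bound[of s] by simp
  next
    case False
    have "1 - s \<le> exp (- s)"
      using exp_ge_add_one_self[of "- s"] by simp
    then have le: "exp s \<le> 1 / (1 - s)"
      using False by (simp add: exp_minus field_simps)
    \<comment> \<open>The product is \<open>1 - s^3\<close>, which is at least 1 for negative
      \<open>s\<close>.\<close>
    have "(1 - s) * (1 + s + s\<^sup>2) = 1 + (- s) * s\<^sup>2"
      by (simp add: algebra_simps power2_eq_square)
    moreover have "0 \<le> (- s) * s\<^sup>2"
      using False by (intro mult_nonneg_nonneg) auto
    ultimately have "1 \<le> (1 - s) * (1 + s + s\<^sup>2)"
      by linarith
    then have "1 / (1 - s) \<le> 1 + s + s\<^sup>2"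
      using False by (simp add: divide_le_eq mult.commute)
    with le show ?thesis by linarith
  qed
  then show ?thesis
    using exp_ge_add_one_self[of s] zero_le_power2[of s] unfolding abs_le_iff by linarith
qed

lemma set_integrable_continuous_compact:
  fixes f :: "'a::euclidean_space \<Rightarrow> 'b::{banach, second_countable_topology}"
  assumes "compact K" "continuous_on K f"
  shows "set_integrable lborel K f"
  unfolding set_integrable_def by (rule borel_integrable_compact[OF assms])

lemma set_integral_inner_right:
  fixes f :: "'a \<Rightarrow> 'b::euclidean_space"
  assumes "set_integrable M A f"
  shows "(LINT y:A|M. h \<bullet> f y) = h \<bullet> (LINT y:A|M. f y)"
  using integral_inner_right[of h M "\<lambda>y. indicator A y *\<^sub>R f y"] assms
  by (simp add: set_lebesgue_integral_def set_integrable_def)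

text \<open>Differentiation under the integral: once \<open>norm h * R \<le> 1\<close>, the
  remainder of the integrand is at most \<open>norm h\<close> squared times an integrable function,
  uniformly on \<open>K\<close>. Taking \<open>g\<close> constant gives the total mass and taking
  \<open>g\<close> the identity gives the first moment.\<close>

lemma has_derivative_laplace_integral:
  fixes K :: "'a::euclidean_space set" and g :: "'a \<Rightarrow> 'b::{banach, second_countable_topology}"
  assumes K: "compact K" and g: "continuous_on K g"
  shows "((\<lambda>x. LINT y:K|lborel. exp (x \<bullet> y) *\<^sub>R g y) has_derivative
          (\<lambda>h. LINT y:K|lborel. ((h \<bullet> y) * exp (x \<bullet> y)) *\<^sub>R g y)) (at x)"
    (is "(?F has_derivative ?D x) (at x)")
proof -
  obtain R where R: "R > 0" "\<And>y. y \<in> K \<Longrightarrow> norm y \<le> R"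
    using compact_imp_bounded[OF K] bounded_pos by blast
  define C where "C = (LINT y:K|lborel. R\<^sup>2 * (exp (x \<bullet> y) * norm (g y)))"
  note int = set_integrable_continuous_compact[OF K]
  show ?thesis
  proof (rule has_derivativeI_sandwich[of "1 / R" _ _ _ _ "\<lambda>y. C * norm (y - x)"])
    show "0 < 1 / R" using R by simp
    show "bounded_linear (?D x)"
    proof (rule linear_conv_bounded_linear[THEN iffD1], rule linearI)
      fix a b show "?D x (a + b) = ?D x a + ?D x b"
        by (subst set_integral_add(2)[symmetric])
          (auto intro!: int continuous_intros g simp: algebra_simps)
      fix r show "?D x (r *\<^sub>R a) = r *\<^sub>R ?D x a"
        by (subst set_integral_scaleR_right[symmetric]) (simp add: mult.assoc)
    qed
    show "((\<lambda>y. C * norm (y - x)) \<longlongrightarrow> 0) (at x)"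
      by (auto intro!: tendsto_eq_intros)
    fix z assume z: "z \<noteq> x" "dist z x < 1 / R"
    define h where "h = z - x"
    have h: "norm h * R \<le> 1" "z = x + h" "h \<noteq> 0"
      using z R by (auto simp: h_def dist_norm field_simps)
    have eq: "?F z - ?F x - ?D x (z - x) =
       (LINT y:K|lborel. (exp (x \<bullet> y) * (exp (h \<bullet> y) - 1 - h \<bullet> y)) *\<^sub>R g y)"
      unfolding h(2)
      by (subst set_integral_diff(2)[symmetric], (auto intro!: int continuous_intros g)[2])+
        (simp add: algebra_simps exp_add)
    have "norm (?F z - ?F x - ?D x (z - x)) \<le>
       (LINT y:K|lborel. norm ((exp (x \<bullet> y) * (exp (h \<bullet> y) - 1 - h \<bullet> y)) *\<^sub>R g y))"
      unfolding eq
      by (rule set_integral_norm_bound) (auto intro!: int continuous_intros g)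
    also have "\<dots> \<le> (LINT y:K|lborel. (norm h)\<^sup>2 * (R\<^sup>2 * (exp (x \<bullet> y) * norm (g y))))"
    proof (rule set_integral_mono)
      fix y assume y: "y \<in> K"
      have "\<bar>h \<bullet> y\<bar> \<le> norm h * R"
        by (meson Cauchy_Schwarz_ineq2 R(2) mult_left_mono norm_ge_zero order_trans y)
      moreover from this have "(h \<bullet> y)\<^sup>2 \<le> (norm h * R)\<^sup>2"
        by (metis abs_ge_zero power2_abs power_mono)
      ultimately have "\<bar>exp (h \<bullet> y) - 1 - h \<bullet> y\<bar> \<le> (norm h)\<^sup>2 * R\<^sup>2"
        using exp_remainder_le_square[of "h \<bullet> y"] h(1) by (simp add: power_mult_distrib)
      then have "exp (x \<bullet> y) * norm (g y) * \<bar>exp (h \<bullet> y) - 1 - h \<bullet> y\<bar>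
          \<le> exp (x \<bullet> y) * norm (g y) * ((norm h)\<^sup>2 * R\<^sup>2)"
        by (intro mult_left_mono) auto
      then show "norm ((exp (x \<bullet> y) * (exp (h \<bullet> y) - 1 - h \<bullet> y)) *\<^sub>R g y)
          \<le> (norm h)\<^sup>2 * (R\<^sup>2 * (exp (x \<bullet> y) * norm (g y)))"
        by (simp add: abs_mult mult_ac)
    qed (auto intro!: int continuous_intros g)
    also have "\<dots> = (norm h)\<^sup>2 * C"
      by (simp add: C_def)
    finally show "norm (?F z - ?F x - ?D x (z - x)) / norm (z - x) \<le> C * norm (z - x)"
      using h(3) unfolding h_def[symmetric] by (simp add: divide_le_eq power2_eq_square mult_ac)
  qed
qed

text \<open>A zero integral would make \<open>f\<close> vanish almost everywhere on
  \<open>K\<close>, so \<open>K\<close> and its nonempty interior would be null sets. A negligible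
  zero set is allowed because a variance integrand vanishes on a hyperplane.\<close>

lemma set_integral_pos_of_interior:
  fixes f :: "'a::euclidean_space \<Rightarrow> real"
  assumes K: "compact K" "interior K \<noteq> {}" and f: "continuous_on K f"
    and nonneg: "\<And>y. y \<in> K \<Longrightarrow> 0 \<le> f y"
    and N: "negligible {y \<in> K. f y = 0}"
  shows "0 < (LINT y:K|lborel. f y)"
proof -
  have int: "integrable lborel (\<lambda>y. indicator K y *\<^sub>R f y)"
    by (rule borel_integrable_compact[OF K(1) f])
  have "(LINT y:K|lborel. f y) \<noteq> 0"
  proof
    assume "(LINT y:K|lborel. f y) = 0"
    then have "AE y in lborel. indicator K y *\<^sub>R f y = 0"
      unfolding set_lebesgue_integral_def
      by (subst (asm) integral_nonneg_eq_0_iff_AE[OF int]) (auto simp: nonneg indicator_def)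
    then have "AE y in lebesgue. indicator K y *\<^sub>R f y = 0"
      by (rule AE_completion)
    moreover have "AE y in lebesgue. y \<notin> {y \<in> K. f y = 0}"
      using N by (intro AE_not_in) (simp add: negligible_iff_null_sets)
    ultimately have "AE y in lebesgue. y \<notin> K"
      by eventually_elim auto
    then have "K \<in> null_sets lebesgue"
      by (subst AE_iff_null_sets) (use K(1) in \<open>auto simp: lmeasurable_compact fmeasurableD\<close>)
    then have "negligible (interior K)"
      by (metis interior_subset negligible_iff_null_sets negligible_subset)
    then show False
      using K(2) open_not_negligible[of "interior K"] by auto
  qed
  moreover have "0 \<le> (LINT y:K|lborel. f y)"
    using nonneg by (auto simp: set_lebesgue_integral_def indicator_def intro!: integral_nonneg_AE)
  ultimately show ?thesis by linarith
qed

text \<open>\<open>\<Phi>\<close> is a smooth convex function with gradient \<open>F\<close> and Hessian \<open>H\<close>; the last clause, a growth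
  rate of almost the support function of \<open>X\<close>, makes the gradient reach every interior point of \<open>X\<close>.\<close>

definition gradient_potential ::
    "(real^'n) set \<Rightarrow> (real^'n \<Rightarrow> real) \<Rightarrow> (real^'n \<Rightarrow> real^'n) \<Rightarrow> (real^'n \<Rightarrow> real^'n^'n) \<Rightarrow> bool" where
  "gradient_potential X \<Phi> F H \<longleftrightarrow>
     (\<forall>x. (\<Phi> has_derivative (\<lambda>h. h \<bullet> F x)) (at x)) \<and>
     (\<forall>x. (F has_derivative (*v) (H x)) (at x)) \<and>
     (\<forall>x h. h \<noteq> 0 \<longrightarrow> 0 < h \<bullet> (H x *v h)) \<and>
     (\<forall>x. F x \<in> X) \<and>
     (\<forall>e>0. \<exists>C. \<forall>p\<in>X. \<forall>x. x \<bullet> p - e * norm x - C \<le> \<Phi> x)"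

lemma gradient_potential_add:
  assumes "gradient_potential X \<Phi> F H" "gradient_potential Y \<Psi> G J"
  shows "gradient_potential (X + Y) (\<lambda>x. \<Phi> x + \<Psi> x) (\<lambda>x. F x + G x) (\<lambda>x. H x + J x)"
  unfolding gradient_potential_def
proof (intro conjI allI impI)
  fix x h :: "real^'a"
  show "((\<lambda>x. \<Phi> x + \<Psi> x) has_derivative (\<lambda>h. h \<bullet> (F x + G x))) (at x)"
    using assms unfolding gradient_potential_def inner_add_right by (intro has_derivative_add) auto
  show "((\<lambda>x. F x + G x) has_derivative (*v) (H x + J x)) (at x)"
    using assms unfolding gradient_potential_def matrix_vector_mult_add_rdistrib
    by (intro has_derivative_add) auto
  show "F x + G x \<in> X + Y"
    using assms unfolding gradient_potential_def by (auto intro: set_plus_intro)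
  show "0 < h \<bullet> ((H x + J x) *v h)" if "h \<noteq> 0"
    using assms that unfolding gradient_potential_def matrix_vector_mult_add_rdistrib inner_add_right
    by (auto intro: add_pos_pos)
next
  fix e :: real assume "e > 0"
  \<comment> \<open>Each potential receives half of the admissible error \<open>e\<close>.\<close>
  then obtain C D where
    "\<And>p x. p \<in> X \<Longrightarrow> x \<bullet> p - e/2 * norm x - C \<le> \<Phi> x" "\<And>p x. p \<in> Y \<Longrightarrow> x \<bullet> p - e/2 * norm x - D \<le> \<Psi> x"
    using assms unfolding gradient_potential_def by (metis half_gt_zero)
  note CD = this
  have "x \<bullet> (p + q) - e * norm x - (C + D) \<le> \<Phi> x + \<Psi> x" if "p \<in> X" "q \<in> Y" for p q x
    using CD(1)[OF that(1), of x] CD(2)[OF that(2), of x] by (simp add: inner_add_right)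
  then show "\<exists>C. \<forall>p\<in>X + Y. \<forall>x. x \<bullet> p - e * norm x - C \<le> \<Phi> x + \<Psi> x"
    by (intro exI[of _ "C + D"]) (auto elim!: set_plus_elim)
qed

lemma gradient_potential_scale:
  assumes "gradient_potential X \<Phi> F H" and c: "c > 0"
  shows "gradient_potential ((*\<^sub>R) c ` X) (\<lambda>x. c * \<Phi> x) (\<lambda>x. c *\<^sub>R F x) (\<lambda>x. c *\<^sub>R H x)"
  unfolding gradient_potential_def
proof (intro conjI allI impI)
  fix x h :: "real^'a"
  show "((\<lambda>x. c * \<Phi> x) has_derivative (\<lambda>h. h \<bullet> c *\<^sub>R F x)) (at x)"
    using assms unfolding gradient_potential_def inner_scaleR_right
    by (intro has_derivative_mult_right) auto
  show "((\<lambda>x. c *\<^sub>R F x) has_derivative (*v) (c *\<^sub>R H x)) (at x)"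
    using assms unfolding gradient_potential_def scaleR_matrix_vector_assoc[symmetric]
    by (intro has_derivative_scaleR_right) auto
  show "c *\<^sub>R F x \<in> (*\<^sub>R) c ` X"
    using assms unfolding gradient_potential_def by auto
  show "0 < h \<bullet> ((c *\<^sub>R H x) *v h)" if "h \<noteq> 0"
    using assms that unfolding gradient_potential_def scaleR_matrix_vector_assoc[symmetric] by auto
next
  fix e :: real assume "e > 0"
  then have "e / c > 0" using c by simp
  then obtain C where C: "\<And>p x. p \<in> X \<Longrightarrow> x \<bullet> p - e / c * norm x - C \<le> \<Phi> x"
    using assms unfolding gradient_potential_def by metis
  have "x \<bullet> c *\<^sub>R p - e * norm x - c * C \<le> c * \<Phi> x" if "p \<in> X" for p x
    using mult_left_mono[OF C[OF that, of x], of c] c by (simp add: algebra_simps)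
  then show "\<exists>C. \<forall>p\<in>(*\<^sub>R) c ` X. \<forall>x. x \<bullet> p - e * norm x - C \<le> c * \<Phi> x"
    by blast
qed

text \<open>The potential is the logarithmic Laplace transform of \<open>K\<close>: its gradient is the mean and its
  Hessian the covariance of the density proportional to \<open>exp (x \<bullet> y)\<close> on \<open>K\<close>.\<close>

lemma gradient_potential_exists:
  fixes K :: "(real^'n) set"
  assumes "convex_body K"
  shows "\<exists>\<Phi> F H. gradient_potential K \<Phi> F H"
proof -
  have K: "compact K" "convex K" "interior K \<noteq> {}"
    using assms by (auto simp: convex_body_def)
  obtain R where R: "R > 0" "\<And>y. y \<in> K \<Longrightarrow> norm y \<le> R"
    using compact_imp_bounded[OF K(1)] bounded_pos by blast
  note int = set_integrable_continuous_compact[OF K(1)]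
  \<comment> \<open>\<open>Z x\<close> is the total mass and \<open>P x\<close> the first moment of
    the density \<open>exp (x \<bullet> y)\<close> on \<open>K\<close>; \<open>Z'\<close> and
    \<open>P'\<close> are their directional derivatives.\<close>
  define Z where "Z x = (LINT y:K|lborel. exp (x \<bullet> y))" for x
  define P where "P x = (LINT y:K|lborel. exp (x \<bullet> y) *\<^sub>R y)" for x
  define Z' where "Z' x h = (LINT y:K|lborel. (h \<bullet> y) * exp (x \<bullet> y))" for x h
  define P' where "P' x h = (LINT y:K|lborel. ((h \<bullet> y) * exp (x \<bullet> y)) *\<^sub>R y)" for x h
  have Zpos: "Z x > 0" for x
    unfolding Z_def by (intro set_integral_pos_of_interior K continuous_intros) auto
  have dZ: "(Z has_derivative Z' x) (at x)" for x
    using has_derivative_laplace_integral[OF K(1), of "\<lambda>_. 1::real" x]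
    unfolding Z_def[abs_def] Z'_def[abs_def] by simp
  have dP: "(P has_derivative P' x) (at x)" for x
    using has_derivative_laplace_integral[OF K(1), of "\<lambda>y. y" x]
    unfolding P_def[abs_def] P'_def[abs_def] by (simp add: continuous_on_id)
  have Z'_eq: "Z' x h = h \<bullet> P x" for x h
  proof -
    have "h \<bullet> P x = (LINT y:K|lborel. h \<bullet> (exp (x \<bullet> y) *\<^sub>R y))"
      unfolding P_def
      by (intro set_integral_inner_right[symmetric] int continuous_intros)
    then show ?thesis by (simp add: Z'_def mult.commute)
  qed
  define \<Phi> where "\<Phi> x = ln (Z x)" for x
  define F where "F x = inverse (Z x) *\<^sub>R P x" for x
  define F' where "F' x h = inverse (Z x) *\<^sub>R P' x h
      + (- (inverse (Z x) * Z' x h * inverse (Z x))) *\<^sub>R P x" for x h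
  define H where "H x = matrix (F' x)" for x
  have dF: "(F has_derivative F' x) (at x)" for x
    unfolding F_def[abs_def] F'_def[abs_def]
    by (rule has_derivative_scaleR[OF Deriv.has_derivative_inverse[OF _ dZ] dP]) (use Zpos[of x] in simp)
  have H: "(*v) (H x) = F' x" for x
    unfolding H_def using matrix_vector_mul(2)[OF has_derivative_linear[OF dF]] by metis
  have "gradient_potential K \<Phi> F H"
    unfolding gradient_potential_def
  proof (intro conjI allI impI)
    fix x :: "real^'n"
    show "(\<Phi> has_derivative (\<lambda>h. h \<bullet> F x)) (at x)"
      using has_derivative_ln[OF Zpos dZ, of x] unfolding \<Phi>_def[abs_def] F_def
      by (simp add: Z'_eq[abs_def] mult.commute)
    show "(F has_derivative (*v) (H x)) (at x)"
      unfolding H by (rule dF)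
    \<comment> \<open>A hyperplane strictly separating the mean from \<open>K\<close> would, after
      averaging over \<open>K\<close>, separate the mean from itself.\<close>
    show "F x \<in> K"
    proof (rule ccontr)
      assume "F x \<notin> K"
      then obtain a b where ab: "a \<bullet> F x < b" "\<And>y. y \<in> K \<Longrightarrow> a \<bullet> y > b"
        using separating_hyperplane_closed_point[OF K(2) compact_imp_closed[OF K(1)]] by metis
      have "b * Z x = (LINT y:K|lborel. b * exp (x \<bullet> y))"
        by (simp add: Z_def)
      also have "\<dots> \<le> Z' x a"
        unfolding Z'_def
        by (intro set_integral_mono int continuous_intros mult_right_mono) (auto intro: less_imp_le ab)
      also have "\<dots> = (a \<bullet> F x) * Z x"
        using Zpos[of x] by (simp add: Z'_eq F_def)
      finally show False using ab(1) Zpos[of x] by simp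
    qed
  next
    fix x h :: "real^'n" assume h: "h \<noteq> 0"
    \<comment> \<open>\<open>m\<close> is the mean of \<open>h \<bullet> y\<close>. The unnormalized
      variance is positive, and expanding its square shows that it equals \<open>Z x\<close> times
      the Hessian form at \<open>h\<close>.\<close>
    define m where "m = Z' x h / Z x"
    have "h \<bullet> P' x h = (LINT y:K|lborel. h \<bullet> (((h \<bullet> y) * exp (x \<bullet> y)) *\<^sub>R y))"
      unfolding P'_def
      by (intro set_integral_inner_right[symmetric] int continuous_intros)
    then have hP': "h \<bullet> P' x h = (LINT y:K|lborel. (h \<bullet> y)\<^sup>2 * exp (x \<bullet> y))"
      by (simp add: power2_eq_square mult_ac)
    have "0 < (LINT y:K|lborel. (h \<bullet> y - m)\<^sup>2 * exp (x \<bullet> y))"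
    proof (intro set_integral_pos_of_interior K continuous_intros)
      have "negligible {y. h \<bullet> y = m}"
        using h by (simp add: negligible_hyperplane)
      then show "negligible {y \<in> K. (h \<bullet> y - m)\<^sup>2 * exp (x \<bullet> y) = 0}"
        by (rule negligible_subset) auto
    qed auto
    also have "\<dots> = (LINT y:K|lborel. (h \<bullet> y)\<^sup>2 * exp (x \<bullet> y) - 2 * m * ((h \<bullet> y) * exp (x \<bullet> y))
                        + m\<^sup>2 * exp (x \<bullet> y))"
      by (simp add: power2_eq_square algebra_simps)
    also have "\<dots> = h \<bullet> P' x h - 2 * m * Z' x h + m\<^sup>2 * Z x"
      unfolding hP' Z'_def Z_def
      by (subst set_integral_add(2) set_integral_diff(2), (auto intro!: int continuous_intros)[2])+
        (simp add: mult.assoc)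
    also have "\<dots> = Z x * (h \<bullet> F' x h)"
    proof -
      have "h \<bullet> F' x h = inverse (Z x) * (h \<bullet> P' x h) - inverse (Z x) * Z' x h * inverse (Z x) * Z' x h"
        unfolding F'_def inner_add_right inner_scaleR_right Z'_eq by simp
      then show ?thesis
        using Zpos[of x] by (simp add: m_def field_simps power2_eq_square)
    qed
    finally show "0 < h \<bullet> (H x *v h)"
      unfolding H using Zpos[of x] by (simp add: zero_less_mult_iff)
  next
    fix e :: real assume e: "e > 0"
    \<comment> \<open>Contracting \<open>K\<close> towards \<open>p\<close> by the factor
      \<open>r\<close> puts every point within \<open>2 * r * R \<le> e\<close> of \<open>p\<close>.
      On this copy \<open>S\<close> of \<open>K\<close> the integrand is at least
      \<open>exp (x \<bullet> p - e * norm x)\<close>, and the volume of \<open>S\<close> depends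
      neither on \<open>p\<close> nor on \<open>x\<close>.\<close>
    define r where "r = min 1 (e / (2 * R))"
    have r: "0 < r" "r \<le> 1" "2 * r * R \<le> e"
      using e R(1) by (auto simp: r_def min_def field_simps)
    have vol: "measure lborel K > 0"
      using set_integral_pos_of_interior[OF K(1,3), of "\<lambda>_. 1"]
      by (simp add: set_lebesgue_integral_def)
    have "x \<bullet> p - e * norm x - (- ln (r ^ CARD('n) * measure lborel K)) \<le> \<Phi> x" if p: "p \<in> K" for p x
    proof -
      define S where "S = (\<lambda>q. (1 - r) *\<^sub>R p + r *\<^sub>R q) ` K"
      have S: "compact S" "S \<subseteq> K"
      proof -
        show "compact S" unfolding S_def
          by (intro compact_continuous_image continuous_intros K)
        show "S \<subseteq> K" unfolding S_def
          using r p convexD_alt[OF K(2)] by auto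
      qed
      have "measure lebesgue S = r ^ CARD('n) * measure lebesgue K"
        using measure_lebesgue_affine[of r "(1 - r) *\<^sub>R p" K] r by (simp add: S_def add.commute)
      then have measS: "measure lborel S = r ^ CARD('n) * measure lborel K"
        using S(1) K(1) by (simp add: borel_compact)
      have low: "exp (x \<bullet> p - e * norm x) \<le> exp (x \<bullet> y)" if y: "y \<in> S" for y
      proof -
        obtain q where q: "q \<in> K" "y = (1 - r) *\<^sub>R p + r *\<^sub>R q"
          using y unfolding S_def by blast
        have "\<bar>x \<bullet> (q - p)\<bar> \<le> norm x * (2 * R)"
          by (rule order_trans[OF Cauchy_Schwarz_ineq2], rule mult_left_mono)
            (use R(2)[OF q(1)] R(2)[OF p] norm_triangle_ineq4[of q p] in auto)
        then have "r * \<bar>x \<bullet> (q - p)\<bar> \<le> r * (norm x * (2 * R))"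
          using r by (intro mult_left_mono) auto
        also have "\<dots> \<le> e * norm x"
          using mult_right_mono[OF r(3), of "norm x"] by (simp add: mult_ac)
        finally have "r * (x \<bullet> (q - p)) \<ge> - (e * norm x)"
          using r by (smt (verit) mult_minus_right mult_left_mono)
        then show ?thesis
          unfolding q(2) by (simp add: inner_add_right inner_diff_right algebra_simps)
      qed
      have "exp (x \<bullet> p - e * norm x) * (r ^ CARD('n) * measure lborel K) =
             (LINT y:S|lborel. exp (x \<bullet> p - e * norm x))"
        using S(1) by (simp add: measS[symmetric] set_lebesgue_integral_def borel_compact
          emeasure_compact_finite)
      also have "\<dots> \<le> (LINT y:S|lborel. exp (x \<bullet> y))"
        by (intro set_integral_mono set_integrable_continuous_compact[OF S(1)] continuous_intros low)
      also have "\<dots> \<le> Z x"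
        unfolding Z_def set_lebesgue_integral_def
        by (rule integral_mono, (intro borel_integrable_compact S(1) K(1) continuous_intros)+)
          (use S(2) in \<open>auto split: split_indicator\<close>)
      finally have "ln (exp (x \<bullet> p - e * norm x) * (r ^ CARD('n) * measure lborel K)) \<le> \<Phi> x"
        unfolding \<Phi>_def using r vol by (subst ln_le_cancel_iff) (auto simp: Zpos)
      then show ?thesis
        using r vol by (subst (asm) ln_mult) auto
    qed
    then show "\<exists>C. \<forall>p\<in>K. \<forall>x. x \<bullet> p - e * norm x - C \<le> \<Phi> x"
      by blast
  qed
  then show ?thesis by blast
qed

text \<open>On the segment from the identity to \<open>A\<close> the quadratic form stays positive,
  so no matrix on it is singular; by the intermediate value theorem the determinant keeps the sign
  it has at the identity.\<close>

lemma det_pos_if_positive_definite: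
  fixes A :: "real^'n^'n"
  assumes pos: "\<And>h. h \<noteq> 0 \<Longrightarrow> 0 < h \<bullet> (A *v h)"
  shows "0 < det A"
proof -
  define B where "B t = (1 - t) *\<^sub>R mat 1 + t *\<^sub>R A" for t
  have nz: "det (B t) \<noteq> 0" if t: "0 \<le> t" "t \<le> 1" for t
  proof -
    have "h = 0" if "B t *v h = 0" for h
    proof (rule ccontr)
      assume h: "h \<noteq> 0"
      have "0 < (1 - t) * (h \<bullet> h) + t * (h \<bullet> (A *v h))"
      proof (cases "t = 0")
        case False
        then show ?thesis using t pos[OF h] by (intro add_nonneg_pos) auto
      qed (use h in simp)
      also have "\<dots> = h \<bullet> (B t *v h)"
        by (simp add: B_def matrix_vector_mult_add_rdistrib inner_add_right
            scaleR_matrix_vector_assoc[symmetric])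
      finally show False using that by simp
    qed
    then have "inj ((*v) (B t))"
      by (simp add: linear_injective_0[OF matrix_vector_mul_linear])
    then show ?thesis
      by (metis det_nz_iff_inj matrix_of_matrix_vector_mul matrix_vector_mul_linear)
  qed
  have cont: "continuous_on {0..1} (\<lambda>t. det (B t))"
    unfolding det_def B_def by (intro continuous_intros)
  have "\<not> det A \<le> 0"
  proof
    assume "det A \<le> 0"
    then have "\<exists>t\<ge>0. t \<le> 1 \<and> det (B t) = 0"
      by (intro IVT2'[OF _ _ _ cont]) (auto simp: B_def)
    then show False using nz by auto
  qed
  then show ?thesis by simp
qed

section \<open>Volume as an integral of Hessian determinants\<close>

lemma has_derivative_along_line:
  fixes F :: "real^'n \<Rightarrow> real^'n"
  assumes "(F has_derivative (*v) A) (at (y + t *\<^sub>R h))"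
  shows "((\<lambda>t. F (y + t *\<^sub>R h) \<bullet> v) has_real_derivative ((A *v h) \<bullet> v)) (at t)"
proof -
  have "((\<lambda>t. y + t *\<^sub>R h) has_derivative (\<lambda>s. s *\<^sub>R h)) (at t)"
    by (auto intro!: derivative_eq_intros)
  from has_derivative_inner_left[OF has_derivative_compose[OF this assms], of v]
  have "((\<lambda>t. F (y + t *\<^sub>R h) \<bullet> v) has_derivative (\<lambda>s. (A *v (s *\<^sub>R h)) \<bullet> v)) (at t)" .
  moreover have "(\<lambda>s. (A *v (s *\<^sub>R h)) \<bullet> v) = (*) ((A *v h) \<bullet> v)"
    by (rule ext) (simp only: linear_scale[OF matrix_vector_mul_linear[of A]] inner_scaleR_left mult.commute)
  ultimately show ?thesis
    by (simp add: has_field_derivative_def)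
qed

text \<open>If \<open>x\<close> and \<open>y\<close> had the same image, the component of
  \<open>F\<close> along \<open>x - y\<close> would take equal values at both ends of the segment,
  although positive definiteness of the Hessian makes it strictly increasing there.\<close>

lemma gradient_potential_inj:
  assumes "gradient_potential X \<Phi> F H"
  shows "inj F"
proof (rule injI, rule ccontr)
  fix x y assume eq: "F x = F y" and ne: "x \<noteq> y"
  define h where "h = x - y"
  have "F (y + 0 *\<^sub>R h) \<bullet> h < F (y + 1 *\<^sub>R h) \<bullet> h"
  proof (rule DERIV_pos_imp_increasing[where f = "\<lambda>t. F (y + t *\<^sub>R h) \<bullet> h"])
    fix t :: real
    have "0 < h \<bullet> (H (y + t *\<^sub>R h) *v h)"
      using assms ne by (simp add: gradient_potential_def h_def)
    then show "\<exists>D. ((\<lambda>t. F (y + t *\<^sub>R h) \<bullet> h) has_real_derivative D) (at t) \<and> 0 < D"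
      using assms has_derivative_along_line[of F "H (y + t *\<^sub>R h)" y t h h]
      by (auto simp: gradient_potential_def inner_commute)
  qed simp
  then show False
    using eq by (simp add: h_def)
qed

text \<open>The range is open by invariance of domain, hence lies in the interior. Conversely, an
  interior point \<open>p\<close> is the gradient at a minimum of
  \<open>\<Phi> x - x \<bullet> p\<close>, which exists because this function grows linearly at
  infinity.\<close>

lemma gradient_potential_image:
  fixes X :: "(real^'n) set"
  assumes X: "gradient_potential X \<Phi> F H"
  shows "range F = interior X"
proof
  have "continuous_on UNIV F"
    using X unfolding gradient_potential_def
    by (meson has_derivative_continuous continuous_at_imp_continuous_on)
  then have "open (range F)"
    using invariance_of_domain_gen[of UNIV F] gradient_potential_inj[OF X] by auto
  moreover have "range F \<subseteq> X"
    using X by (auto simp: gradient_potential_def)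
  ultimately show "range F \<subseteq> interior X"
    by (simp add: interior_maximal)
next
  show "interior X \<subseteq> range F"
  proof
    fix p assume "p \<in> interior X"
    then obtain e where e: "e > 0" "cball p e \<subseteq> X"
      by (meson mem_interior_cball)
    obtain C where C: "\<And>q x. q \<in> X \<Longrightarrow> x \<bullet> q - e / 2 * norm x - C \<le> \<Phi> x"
      using X e unfolding gradient_potential_def by (metis half_gt_zero)
    define f where "f x = \<Phi> x - x \<bullet> p" for x
    have low: "e / 2 * norm x - C \<le> f x" for x
    proof -
      \<comment> \<open>The ball around \<open>p\<close> contains a point that gains
        \<open>e * norm x\<close> over \<open>p\<close> in the direction of \<open>x\<close>; the
        error term of the growth bound costs only half of that.\<close>
      have "p + e *\<^sub>R sgn x \<in> X"
        using e by (intro subsetD[OF e(2)]) (simp add: dist_norm norm_sgn)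
      from C[OF this, of x] have "x \<bullet> p + e * (x \<bullet> sgn x) - e / 2 * norm x - C \<le> \<Phi> x"
        by (simp add: inner_add_right)
      moreover have "x \<bullet> sgn x = norm x"
        by (cases "x = 0") (simp_all add: sgn_div_norm divide_inverse[symmetric] dot_square_norm power2_eq_square)
      ultimately show ?thesis
        by (simp add: f_def)
    qed
    have df: "(f has_derivative (\<lambda>h. h \<bullet> F x - h \<bullet> p)) (at x)" for x
      unfolding f_def[abs_def] using X unfolding gradient_potential_def
      by (intro has_derivative_diff has_derivative_inner_left has_derivative_ident) auto
    \<comment> \<open>Outside this radius \<open>low\<close> gives values above \<open>f 0\<close>,
      so a minimum over the ball is global. The maximum with 0 keeps the ball nonempty.\<close>
    define r where "r = max 0 (2 * (f 0 + C) / e)"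
    have "continuous_on (cball 0 r) f"
      by (meson df has_derivative_continuous continuous_at_imp_continuous_on)
    then obtain x where x: "\<And>y. y \<in> cball 0 r \<Longrightarrow> f x \<le> f y" "x \<in> cball 0 r"
      using continuous_attains_inf[of "cball 0 r" f] by (metis compact_cball cball_eq_empty max.cobounded1 not_less r_def)
    have "f x \<le> f y" for y
    proof (cases "norm y \<le> r")
      case False
      then have "2 * (f 0 + C) / e < norm y" by (simp add: r_def)
      then have "f 0 < e / 2 * norm y - C" using e by (simp add: field_simps)
      also have "\<dots> \<le> f y" by (rule low)
      finally show ?thesis using x(1)[of 0] by (simp add: r_def)
    qed (use x in simp)
    then have "(\<lambda>h. h \<bullet> F x - h \<bullet> p) = (\<lambda>h. 0)"
      using differential_zero_maxmin[OF UNIV_I open_UNIV df] by blast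
    then have "h \<bullet> (F x - p) = 0" for h
      by (metis inner_diff_right)
    then have "F x - p = 0"
      using inner_eq_zero_iff by blast
    then show "p \<in> range F" by auto
  qed
qed

lemma has_integral_det_gradient_potential:
  fixes X :: "(real^'m::{finite,wellorder}) set"
  assumes X: "gradient_potential X \<Phi> F H" and bc: "bounded X" "convex X"
  shows "((\<lambda>x. det (H x)) has_integral measure lebesgue X) UNIV"
proof -
  have pos: "0 < det (H x)" for x
    using X det_pos_if_positive_definite[of "H x"] by (simp add: gradient_potential_def)
  have "interior X \<in> lmeasurable"
    using bc by (simp add: lmeasurable_interior)
  then have "((\<lambda>x. \<bar>det (matrix ((*v) (H x)))\<bar>) has_integral measure lebesgue (interior X)) UNIV"
    using has_measure_differentiable_image[of UNIV F "\<lambda>x. (*v) (H x)" "measure lebesgue (interior X)"]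
      X gradient_potential_inj[OF X] gradient_potential_image[OF X]
    by (simp add: gradient_potential_def)
  moreover have "measure lebesgue (interior X) = measure lebesgue X"
    using bc measure_interior negligible_convex_frontier by blast
  ultimately show ?thesis
    using pos by (simp add: less_imp_le matrix_of_matrix_vector_mul)
qed

text \<open>The second disjunct admits zero coefficients in nonnegative combinations of convex bodies.\<close>

definition hessian_of :: "(real^'m) set \<Rightarrow> (real^'m \<Rightarrow> real^'m^'m) \<Rightarrow> bool" where
  "hessian_of X H \<longleftrightarrow> (compact X \<and> convex X \<and> (\<exists>\<Phi> F. gradient_potential X \<Phi> F H)) \<or>
     (X = {0} \<and> H = (\<lambda>_. 0))"

lemma hessian_of_exists: "convex_body X \<Longrightarrow> \<exists>H. hessian_of X H"
  using gradient_potential_exists[of X] by (auto simp: hessian_of_def convex_body_def)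

lemma hessian_of_zero: "hessian_of {0} (\<lambda>_. 0)"
  by (simp add: hessian_of_def)

lemma compact_set_plus:
  fixes X Y :: "'a::real_normed_vector set"
  assumes "compact X" "compact Y"
  shows "compact (X + Y)"
proof -
  have "X + Y = {x + y | x y. x \<in> X \<and> y \<in> Y}" by (auto simp: set_plus_def)
  then show ?thesis using compact_sums[OF assms] by simp
qed

lemma hessian_of_add:
  assumes "hessian_of X H" "hessian_of Y J"
  shows "hessian_of (X + Y) (\<lambda>x. H x + J x)"
proof -
  consider "X = 0" "H = (\<lambda>_. 0)" | "Y = 0" "J = (\<lambda>_. 0)"
    | \<Phi> F \<Psi> G where "gradient_potential X \<Phi> F H" "gradient_potential Y \<Psi> G J"
        "compact X" "compact Y" "convex X" "convex Y"
    using assms unfolding hessian_of_def set_zero[symmetric] by blast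
  then show ?thesis
  proof cases
    case 3
    then show ?thesis
      unfolding hessian_of_def using gradient_potential_add[OF 3(1,2)]
      by (intro disjI1 conjI compact_set_plus convex_set_plus exI)
  qed (use assms in simp_all)
qed

lemma hessian_of_scale:
  assumes "hessian_of X H" "c \<ge> 0"
  shows "hessian_of ((*\<^sub>R) c ` X) (\<lambda>x. c *\<^sub>R H x)"
proof (cases "c = 0")
  case True
  have "X \<noteq> {}"
    using assms(1) by (auto simp: hessian_of_def gradient_potential_def)
  then show ?thesis
    using True by (auto simp: hessian_of_def)
next
  case False
  then have "c > 0" using assms(2) by simp
  then show ?thesis
    using assms(1) unfolding hessian_of_def
    by (elim disjE conjE exE) (auto simp: compact_scaling convex_scaling dest: gradient_potential_scale)
qed

lemma hessian_of_sum:
  assumes "finite S" "\<And>i. i \<in> S \<Longrightarrow> hessian_of (X i) (H i)"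
  shows "hessian_of (\<Sum>i\<in>S. X i) (\<lambda>x. \<Sum>i\<in>S. H i x)"
  using assms
  by (induction S rule: finite_induct) (auto simp: hessian_of_zero set_zero hessian_of_add)

lemma has_integral_det_hessian_of:
  fixes X :: "(real^'m::{finite,wellorder}) set"
  assumes "hessian_of X H"
  shows "((\<lambda>x. det (H x)) has_integral measure lebesgue X) UNIV"
  using assms unfolding hessian_of_def
proof (elim disjE conjE exE)
  assume "X = {0}" "H = (\<lambda>_. 0)"
  then show ?thesis
    using det_0[where 'n='m and 'a=real] by (simp add: mat_0 negligible_imp_measure0)
qed (auto intro: has_integral_det_gradient_potential compact_imp_bounded)

section \<open>Mixed discriminants and polarized volume\<close>

text \<open>The determinant is multilinear in the rows; \<open>f\<close> selects the summand from
  which each row is taken.\<close>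

lemma det_sum_rows:
  fixes A :: "'i \<Rightarrow> real^'n^'n"
  assumes "finite S"
  shows "det (\<Sum>i\<in>S. A i) = (\<Sum>f | range f \<subseteq> S. det (\<chi> r. A (f r) $ r))"
proof -
  have PiE: "{f :: 'n \<Rightarrow> 'i. range f \<subseteq> S} = PiE UNIV (\<lambda>_. S)"
    by (auto simp: PiE_def Pi_def)
  have "det (\<Sum>i\<in>S. A i) = (\<Sum>p | p permutes UNIV. of_int (sign p) * (\<Prod>r\<in>UNIV. \<Sum>i\<in>S. A i $ r $ p r))"
    by (simp add: det_def sum_component)
  also have "\<dots> = (\<Sum>p | p permutes UNIV. \<Sum>f | range f \<subseteq> S. of_int (sign p) * (\<Prod>r\<in>UNIV. A (f r) $ r $ p r))"
    using assms by (subst prod_sum_PiE) (simp_all add: PiE sum_distrib_left)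
  also have "\<dots> = (\<Sum>f | range f \<subseteq> S. det (\<chi> r. A (f r) $ r))"
    by (subst sum.swap) (simp add: det_def)
  finally show ?thesis .
qed

text \<open>The polarization of the determinant: \<open>\<sigma>\<close> deals the matrices out to
  the rows, and division by the factorial makes the value at equal matrices their
  determinant.\<close>

definition mixed_disc :: "(nat \<Rightarrow> real^'n^'n) \<Rightarrow> real" where
  "mixed_disc A = (\<Sum>\<sigma> | bij_betw \<sigma> UNIV {..<CARD('n)}. det (\<chi> r. A (\<sigma> r) $ r)) / fact CARD('n)"

lemma range_eq_lessThan_iff_bij_betw:
  "range (f :: 'n::finite \<Rightarrow> nat) = {..<CARD('n)} \<longleftrightarrow> bij_betw f UNIV {..<CARD('n)}"
  unfolding bij_betw_def by (metis card_lessThan eq_card_imp_inj_on finite)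

text \<open>Each determinant of a partial sum expands into choices of rows from \<open>S\<close>.
  Inclusion-exclusion keeps the choices whose range is all of the \<open>n\<close> indices, and on
  \<open>n\<close> rows these are the bijections.\<close>

lemma mixed_disc_polarization:
  fixes A :: "nat \<Rightarrow> real^'n^'n"
  shows "(\<Sum>S\<in>Pow {..<CARD('n)}. (- 1) ^ (CARD('n) - card S) * det (\<Sum>i\<in>S. A i)) = fact CARD('n) * mixed_disc A"
proof -
  define d where "d f = det (\<chi> r. A (f r) $ r)" for f :: "'n \<Rightarrow> nat"
  define G where "G S = (\<Sum>f | range f \<subseteq> S. d f)" for S
  define F where "F S = (\<Sum>f | range f = S. d f)" for S
  have GF: "G S = sum F (Pow S)" if "finite S" for S
  proof -
    have "{f :: 'n \<Rightarrow> nat. range f \<subseteq> S} = PiE UNIV (\<lambda>_. S)"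
      by (auto simp: PiE_def Pi_def)
    then have "finite {f :: 'n \<Rightarrow> nat. range f \<subseteq> S}"
      using that by (simp add: finite_PiE)
    then have "G S = (\<Sum>T\<in>Pow S. \<Sum>f\<in>{f \<in> {f. range f \<subseteq> S}. range f = T}. d f)"
      unfolding G_def using that by (intro sum.group[symmetric]) auto
    also have "\<dots> = sum F (Pow S)"
      unfolding F_def by (intro sum.cong arg_cong2[of _ _ _ _ sum]) auto
    finally show ?thesis .
  qed
  have "(\<Sum>S\<in>Pow {..<CARD('n)}. (- 1) ^ (CARD('n) - card S) * det (\<Sum>i\<in>S. A i)) =
        (\<Sum>S\<in>Pow {..<CARD('n)}. (- 1) ^ (card {..<CARD('n)} - card S) * G S)"
    by (intro sum.cong) (auto simp: G_def d_def det_sum_rows finite_subset)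
  also have "\<dots> = F {..<CARD('n)}"
    by (rule inclusion_exclusion_mobius[symmetric]) (auto simp: GF)
  finally show ?thesis
    by (simp add: F_def d_def mixed_disc_def range_eq_lessThan_iff_bij_betw)
qed

text \<open>Every assignment contributes \<open>det A\<close>. The assignments are a fixed bijection
  \<open>e\<close> composed with the permutations of the rows, so there are \<open>n!\<close> of
  them.\<close>

lemma mixed_disc_const:
  fixes A :: "real^'n^'n"
  shows "mixed_disc (\<lambda>_. A) = det A"
proof -
  obtain e where e: "bij_betw e (UNIV :: 'n set) {..<CARD('n)}"
    by (metis card_lessThan finite finite_lessThan finite_same_card_bij)
  have "bij_betw (\<lambda>p. e \<circ> p) {p. p permutes UNIV} {\<sigma> :: 'n \<Rightarrow> nat. bij_betw \<sigma> UNIV {..<CARD('n)}}"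
  proof (rule bij_betw_byWitness[where f' = "\<lambda>\<sigma>. inv e \<circ> \<sigma>"])
    have inj: "inj e" using e by (simp add: bij_betw_def)
    then show "\<forall>p\<in>{p. p permutes UNIV}. inv e \<circ> (e \<circ> p) = p"
      by (simp add: fun_eq_iff)
    show "\<forall>\<sigma>\<in>{\<sigma>. bij_betw \<sigma> UNIV {..<CARD('n)}}. e \<circ> (inv e \<circ> \<sigma>) = \<sigma>"
      using e by (auto simp: fun_eq_iff bij_betw_def intro!: f_inv_into_f)
    show "(\<lambda>p. e \<circ> p) ` {p. p permutes UNIV} \<subseteq> {\<sigma>. bij_betw \<sigma> UNIV {..<CARD('n)}}"
      using e by (auto intro: bij_betw_trans dest: permutes_imp_bij)
    show "(\<lambda>\<sigma>. inv e \<circ> \<sigma>) ` {\<sigma>. bij_betw \<sigma> UNIV {..<CARD('n)}} \<subseteq> {p. p permutes UNIV}"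
      using e bij_betw_inv_into[OF e] by (auto intro!: bij_imp_permutes intro: bij_betw_trans)
  qed
  then have "card {\<sigma> :: 'n \<Rightarrow> nat. bij_betw \<sigma> UNIV {..<CARD('n)}} = fact CARD('n)"
    using bij_betw_same_card card_permutations[of UNIV "CARD('n)"] by fastforce
  then show ?thesis
    by (simp add: mixed_disc_def vec_lambda_eta)
qed

text \<open>In each summand exactly one row, \<open>r0\<close>, comes from the matrix with index
  \<open>k\<close>, and the determinant is linear in that row.\<close>

lemma mixed_disc_linear:
  fixes A :: "nat \<Rightarrow> real^'n^'n"
  assumes k: "k < CARD('n)"
  shows "mixed_disc (A(k := a *\<^sub>R X + b *\<^sub>R Y)) = a * mixed_disc (A(k := X)) + b * mixed_disc (A(k := Y))"
proof -
  have "det (\<chi> r. (A(k := a *\<^sub>R X + b *\<^sub>R Y)) (\<sigma> r) $ r) =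
        a * det (\<chi> r. (A(k := X)) (\<sigma> r) $ r) + b * det (\<chi> r. (A(k := Y)) (\<sigma> r) $ r)"
    if \<sigma>: "bij_betw \<sigma> (UNIV :: 'n set) {..<CARD('n)}" for \<sigma>
  proof -
    obtain r0 where "\<sigma> r0 = k"
      using \<sigma> k by (metis bij_betw_imp_surj_on imageE lessThan_iff)
    then have r0: "\<sigma> r = k \<longleftrightarrow> r = r0" for r
      using \<sigma> by (metis UNIV_I bij_betw_inv_into_left)
    have eq: "(\<chi> r. (A(k := Z)) (\<sigma> r) $ r) = (\<chi> r. if r = r0 then Z $ r else A (\<sigma> r) $ r)" for Z
      by (simp add: vec_eq_iff r0)
    have "(\<chi> r. if r = r0 then (a *\<^sub>R X + b *\<^sub>R Y) $ r else A (\<sigma> r) $ r) =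
        (\<chi> r. if r = r0 then a *s X $ r + b *s Y $ r else A (\<sigma> r) $ r)"
      by (simp add: vec_eq_iff)
    then show ?thesis
      unfolding eq using det_row_add[of r0 "\<lambda>r. a *s X $ r" "\<lambda>r. b *s Y $ r" "\<lambda>r. A (\<sigma> r) $ r"]
        det_row_mul[of r0 a "\<lambda>r. X $ r" "\<lambda>r. A (\<sigma> r) $ r"] det_row_mul[of r0 b "\<lambda>r. Y $ r" "\<lambda>r. A (\<sigma> r) $ r"]
      by simp
  qed
  then show ?thesis
    by (simp add: mixed_disc_def sum.distrib sum_distrib_left add_divide_distrib)
qed

text \<open>This is the mixed volume, by polarization of the volume polynomial.\<close>

definition polar_volume :: "(real^'n) set list \<Rightarrow> real" where
  "polar_volume Ks = (\<Sum>S\<in>Pow {..<CARD('n)}. (- 1) ^ (CARD('n) - card S) *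
     measure lebesgue (\<Sum>i\<in>S. Ks ! i)) / fact CARD('n)"

section \<open>Symmetry and multilinearity of the polarized volume\<close>

lemma image_set_plus: "linear f \<Longrightarrow> f ` (A + B) = f ` A + f ` B"
  unfolding set_plus_image image_image by (force simp: linear_add image_iff)

lemma image_set_sum:
  assumes "linear f"
  shows "f ` (\<Sum>i\<in>S. A i) = (\<Sum>i\<in>S. f ` A i)"
  by (induction S rule: infinite_finite_induct)
    (simp_all add: set_zero[symmetric] linear_0[OF assms] image_set_plus[OF assms] del: set_zero,
     simp_all add: set_zero linear_0[OF assms])

lemma compact_set_sum:
  fixes A :: "'i \<Rightarrow> 'a::real_normed_vector set"
  assumes "\<And>i. i \<in> S \<Longrightarrow> compact (A i)"
  shows "compact (\<Sum>i\<in>S. A i)"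
  using assms by (induction S rule: infinite_finite_induct) (simp_all add: compact_set_plus)

lemma polar_volume_permute:
  fixes Ks :: "(real^'n) set list"
  assumes "mset Ls = mset Ks" "length Ks = CARD('n)"
  shows "polar_volume Ls = polar_volume Ks"
proof -
  have len: "length Ls = CARD('n)"
    using assms by (metis size_mset)
  obtain f where f: "bij_betw f {..<CARD('n)} {..<CARD('n)}" "\<And>i. i < CARD('n) \<Longrightarrow> Ls ! i = Ks ! f i"
    using permutation_Ex_bij[OF assms(1)] len assms(2) by auto
  define g where "g S = (- 1) ^ (CARD('n) - card S) * measure lebesgue (\<Sum>i\<in>S. Ks ! i)" for S
  have "(\<Sum>S\<in>Pow {..<CARD('n)}. (- 1) ^ (CARD('n) - card S) * measure lebesgue (\<Sum>i\<in>S. Ls ! i)) =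
        (\<Sum>S\<in>Pow {..<CARD('n)}. g (f ` S))"
  proof (rule sum.cong)
    fix S assume "S \<in> Pow {..<CARD('n)}"
    then have S: "S \<subseteq> {..<CARD('n)}" by simp
    have inj: "inj_on f S"
      using f(1) S by (meson bij_betw_def inj_on_subset)
    have "(\<Sum>i\<in>f ` S. Ks ! i) = (\<Sum>i\<in>S. Ls ! i)"
      unfolding sum.reindex[OF inj] using S f(2) by (intro sum.cong) auto
    then show "(- 1) ^ (CARD('n) - card S) * measure lebesgue (\<Sum>i\<in>S. Ls ! i) =
       g (f ` S)"
      by (simp add: g_def card_image[OF inj])
  qed simp
  also have "\<dots> = (\<Sum>S\<in>Pow {..<CARD('n)}. g S)"
    by (rule sum.reindex_bij_betw[OF bij_betw_Pow[OF f(1)]])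
  finally show ?thesis
    by (simp add: polar_volume_def g_def)
qed

text \<open>The volume of each partial Minkowski sum is the integral of the determinant of the
  summed Hessians; polarization on both sides turns determinants into mixed discriminants and
  volumes into \<open>polar_volume\<close>.\<close>

lemma has_integral_mixed_disc:
  fixes Ks :: "(real^'m::{finite,wellorder}) set list"
  assumes "\<And>i. i < CARD('m) \<Longrightarrow> hessian_of (Ks ! i) (H i)"
  shows "((\<lambda>x. mixed_disc (\<lambda>i. H i x)) has_integral polar_volume Ks) UNIV"
proof -
  have "((\<lambda>x. \<Sum>S\<in>Pow {..<CARD('m)}. (- 1) ^ (CARD('m) - card S) * det (\<Sum>i\<in>S. H i x)) has_integral
        (\<Sum>S\<in>Pow {..<CARD('m)}. (- 1) ^ (CARD('m) - card S) * measure lebesgue (\<Sum>i\<in>S. Ks ! i))) UNIV"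
    by (intro has_integral_sum has_integral_mult_right has_integral_det_hessian_of hessian_of_sum)
      (use assms in \<open>auto intro: finite_subset\<close>)
  from has_integral_divide[OF this, of "fact CARD('m)"] show ?thesis
    by (simp add: polar_volume_def mixed_disc_polarization)
qed

text \<open>Only the Hessian in position \<open>k\<close> changes, and the integrand representing
  the polarized volume is linear in it.\<close>

lemma polar_volume_linear_hessian_of:
  fixes X Y :: "(real^'m::{finite,wellorder}) set"
  assumes len: "length Ks + length Ls + 1 = CARD('m)"
    and ex: "\<And>Z. Z \<in> set Ks \<union> set Ls \<Longrightarrow> \<exists>H. hessian_of Z H"
    and X: "hessian_of X HX" and Y: "hessian_of Y HY" and ab: "a \<ge> 0" "b \<ge> 0"
  shows "polar_volume (Ks @ ((*\<^sub>R) a ` X + (*\<^sub>R) b ` Y) # Ls) =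
         a * polar_volume (Ks @ X # Ls) + b * polar_volume (Ks @ Y # Ls)"
proof -
  define k where "k = length Ks"
  have k: "k < CARD('m)" using len by (simp add: k_def)
  have "\<exists>H. hessian_of ((Ks @ X # Ls) ! i) H" if "i < CARD('m)" for i
  proof -
    have "(Ks @ X # Ls) ! i \<in> set (Ks @ X # Ls)"
      using that len by (intro nth_mem) simp
    then show ?thesis using ex X by auto
  qed
  then obtain H where H: "\<And>i. i < CARD('m) \<Longrightarrow> hessian_of ((Ks @ X # Ls) ! i) (H i)"
    by metis
  have slot: "((\<lambda>x. mixed_disc ((\<lambda>i. H i x)(k := J x))) has_integral polar_volume (Ks @ Z # Ls)) UNIV"
    if "hessian_of Z J" for Z J
  proof -
    have "hessian_of ((Ks @ Z # Ls) ! i) ((H(k := J)) i)" if "i < CARD('m)" for i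
      using H[OF that] \<open>hessian_of Z J\<close> by (auto simp: k_def nth_append nth_Cons' split: if_splits)
    from has_integral_mixed_disc[OF this] show ?thesis
      by (simp add: fun_upd_def if_distrib[of "\<lambda>f. f _"] cong: if_cong)
  qed
  have "((\<lambda>x. mixed_disc ((\<lambda>i. H i x)(k := a *\<^sub>R HX x + b *\<^sub>R HY x))) has_integral
      a * polar_volume (Ks @ X # Ls) + b * polar_volume (Ks @ Y # Ls)) UNIV"
    unfolding mixed_disc_linear[OF k] by (intro has_integral_add has_integral_mult_right slot X Y)
  moreover have "hessian_of ((*\<^sub>R) a ` X + (*\<^sub>R) b ` Y) (\<lambda>x. a *\<^sub>R HX x + b *\<^sub>R HY x)"
    by (intro hessian_of_add hessian_of_scale X Y ab)
  ultimately show ?thesis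
    using has_integral_unique slot by blast
qed

lemma polar_volume_replicate_hessian_of:
  fixes X :: "(real^'m::{finite,wellorder}) set"
  assumes X: "hessian_of X H"
  shows "polar_volume (replicate CARD('m) X) = measure lebesgue X"
proof -
  have "((\<lambda>x. mixed_disc (\<lambda>i::nat. H x)) has_integral polar_volume (replicate CARD('m) X)) UNIV"
    using has_integral_mixed_disc[of "replicate CARD('m) X" "\<lambda>_. H"] X by simp
  then show ?thesis
    unfolding mixed_disc_const using has_integral_unique has_integral_det_hessian_of[OF X] by blast
qed

section \<open>Arbitrary finite index types\<close>

text \<open>The change of variables theorem of the library is restricted to well-ordered index types; this
  type transfers its consequences to an arbitrary finite index type.\<close>

typedef (overloaded) 'n wellordered_index = "{..<CARD('n::finite)}"
  morphisms index_nat nat_index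
  by (auto intro: exI[of _ 0])

instantiation wellordered_index :: (finite) wellorder
begin

definition "x \<le> y \<longleftrightarrow> index_nat x \<le> index_nat y"
definition "x < y \<longleftrightarrow> index_nat x < index_nat y"

instance
proof
  fix P :: "'a wellordered_index \<Rightarrow> bool" and a
  assume *: "\<And>x. (\<And>y. y < x \<Longrightarrow> P y) \<Longrightarrow> P x"
  show "P a"
    by (induction "index_nat a" arbitrary: a rule: less_induct) (metis * less_wellordered_index_def)
qed (auto simp: less_eq_wellordered_index_def less_wellordered_index_def index_nat_inject)

end

lemma bij_betw_index_nat: "bij_betw index_nat (UNIV :: 'n::finite wellordered_index set) {..<CARD('n)}"
  unfolding bij_betw_def inj_on_def
  by (simp add: index_nat_inject type_definition.Rep_range[OF type_definition_wellordered_index])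

instance wellordered_index :: (finite) finite
  by standard (metis bij_betw_index_nat bij_betw_finite finite_lessThan)

lemma card_wellordered_index: "CARD('n::finite wellordered_index) = CARD('n)"
  using bij_betw_same_card[OF bij_betw_index_nat] by simp

section \<open>Invariance of volume under renaming of coordinates\<close>

definition relabel :: "('m \<Rightarrow> 'n) \<Rightarrow> real^'n \<Rightarrow> real^'m" where
  "relabel \<beta> v = (\<chi> i. v $ \<beta> i)"

lemma linear_relabel: "linear (relabel \<beta>)"
  by (rule linearI) (simp_all add: relabel_def vec_eq_iff)

lemma bounded_linear_relabel: "bounded_linear (relabel \<beta>)"
  using linear_relabel linear_conv_bounded_linear by blast

lemma relabel_relabel: "relabel \<beta> (relabel \<gamma> v) = relabel (\<gamma> \<circ> \<beta>) v"
  by (simp add: relabel_def)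

lemma relabel_id [simp]: "relabel id v = v" "relabel (\<lambda>x. x) v = v"
  by (simp_all add: relabel_def vec_eq_iff)

lemma prod_inner_Basis_cart: "(\<Prod>b\<in>Basis. (v :: real^'n) \<bullet> b) = (\<Prod>i\<in>UNIV. v $ i)"
proof -
  have B: "(Basis :: (real^'n) set) = (\<lambda>i. axis i 1) ` UNIV"
    by (auto simp: Basis_vec_def)
  have inj: "inj (\<lambda>i::'n. axis i (1::real))"
    by (simp add: inj_on_def axis_eq_axis)
  show ?thesis
    unfolding B prod.reindex[OF inj] by (simp add: inner_axis)
qed

text \<open>Lebesgue measure is determined by its values on boxes. The preimage of a box is the box
  with renamed corners, and renaming permutes the factors of the product of side lengths.\<close>

lemma lborel_eq_distr_relabel:
  fixes \<beta> :: "'m::finite \<Rightarrow> 'n::finite"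
  assumes \<beta>: "bij \<beta>"
  shows "(lborel :: (real^'m) measure) = distr lborel borel (relabel \<beta>)"
proof (rule lborel_eqI)
  fix l u :: "real^'m" assume le: "\<And>b. b \<in> Basis \<Longrightarrow> l \<bullet> b \<le> u \<bullet> b"
  have inv: "\<beta> (inv \<beta> i) = i" "inv \<beta> (\<beta> j) = j" for i j
    using \<beta> by (simp_all add: bij_is_inj bij_is_surj surj_f_inv_f)
  have meas: "relabel \<beta> \<in> borel_measurable borel"
    by (intro borel_measurable_continuous_onI linear_continuous_on bounded_linear_relabel)
  have "relabel \<beta> -` box l u = box (relabel (inv \<beta>) l) (relabel (inv \<beta>) u)"
    by (auto simp: mem_box_cart relabel_def) (metis inv)+
  moreover have "relabel (inv \<beta>) l \<bullet> b \<le> relabel (inv \<beta>) u \<bullet> b" if "b \<in> Basis" for b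
  proof -
    have "l $ i \<le> u $ i" for i
      using le[of "axis i 1"] by (simp add: inner_axis)
    then show ?thesis
      using that by (auto simp: Basis_vec_def inner_axis relabel_def)
  qed
  ultimately have "emeasure (distr lborel borel (relabel \<beta>)) (box l u) =
      ennreal (\<Prod>b\<in>Basis. (relabel (inv \<beta>) u - relabel (inv \<beta>) l) \<bullet> b)"
    using meas by (simp add: emeasure_distr emeasure_lborel_box)
  also have "(\<Prod>b\<in>Basis. (relabel (inv \<beta>) u - relabel (inv \<beta>) l) \<bullet> b) = (\<Prod>i\<in>UNIV. (u - l) $ inv \<beta> i)"
    by (simp add: prod_inner_Basis_cart relabel_def)
  also have "\<dots> = (\<Prod>b\<in>Basis. (u - l) \<bullet> b)"
    unfolding prod_inner_Basis_cart by (rule prod.reindex_bij_betw[OF bij_imp_bij_inv[OF \<beta>]])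
  finally show "emeasure (distr lborel borel (relabel \<beta>)) (box l u) = ennreal (\<Prod>b\<in>Basis. (u - l) \<bullet> b)" .
qed simp

lemma measure_relabel_image:
  assumes \<beta>: "bij \<beta>" and A: "compact A"
  shows "measure lebesgue (relabel \<beta> ` A) = measure lebesgue A"
proof -
  have cont: "continuous_on S (relabel \<beta>)" for S
    by (intro linear_continuous_on bounded_linear_relabel)
  have comp: "compact (relabel \<beta> ` A)"
    by (intro compact_continuous_image A cont)
  have "inj (relabel \<beta>)"
    using \<beta> by (intro inj_on_inverseI[where g = "relabel (inv \<beta>)"])
      (simp add: relabel_relabel bij_is_surj surj_iff[THEN iffD1])
  then have vim: "relabel \<beta> -` (relabel \<beta> ` A) = A"
    by (simp add: inj_vimage_image_eq)
  have "measure lborel (relabel \<beta> ` A) = measure (distr lborel borel (relabel \<beta>)) (relabel \<beta> ` A)"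
    using lborel_eq_distr_relabel[OF \<beta>] by simp
  also have "\<dots> = measure lborel A"
    using comp by (subst measure_distr) (auto simp: vim borel_compact intro!: borel_measurable_continuous_onI cont)
  finally show ?thesis
    using comp A by (simp add: borel_compact)
qed

lemma convex_body_relabel:
  assumes \<beta>: "bij \<beta>" and K: "convex_body K"
  shows "convex_body (relabel \<beta> ` K)"
proof -
  have "surj (relabel \<beta>)"
    by (rule surjI[where f = "relabel (inv \<beta>)"])
      (use \<beta> in \<open>simp add: relabel_relabel bij_is_inj\<close>)
  then have "open (relabel \<beta> ` interior K)"
    by (intro open_surjective_linear_image linear_relabel) auto
  then have "relabel \<beta> ` interior K \<subseteq> interior (relabel \<beta> ` K)"
    by (simp add: image_mono interior_maximal interior_subset)
  moreover have "continuous_on K (relabel \<beta>)"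
    by (intro linear_continuous_on bounded_linear_relabel)
  ultimately show ?thesis
    using K unfolding convex_body_def
    by (auto intro!: compact_continuous_image convex_linear_image linear_relabel)
qed

lemma polar_volume_relabel:
  fixes \<beta> :: "'m::finite \<Rightarrow> 'n::finite"
  assumes \<beta>: "bij \<beta>" and Ks: "\<And>K. K \<in> set Ks \<Longrightarrow> compact K" "length Ks = CARD('n)"
  shows "polar_volume (map ((`) (relabel \<beta>)) Ks) = polar_volume Ks"
proof -
  have card: "CARD('m) = CARD('n)"
    using \<beta> by (rule bij_betw_same_card)
  have "measure lebesgue (\<Sum>i\<in>S. map ((`) (relabel \<beta>)) Ks ! i) = measure lebesgue (\<Sum>i\<in>S. Ks ! i)"
    if "S \<subseteq> {..<CARD('n)}" for S
  proof -
    have "(\<Sum>i\<in>S. map ((`) (relabel \<beta>)) Ks ! i) = (\<Sum>i\<in>S. relabel \<beta> ` (Ks ! i))"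
      using that Ks(2) by (intro sum.cong) auto
    also have "\<dots> = relabel \<beta> ` (\<Sum>i\<in>S. Ks ! i)"
      by (simp add: image_set_sum linear_relabel)
    also have "measure lebesgue \<dots> = measure lebesgue (\<Sum>i\<in>S. Ks ! i)"
      using that Ks by (intro measure_relabel_image \<beta> compact_set_sum) auto
    finally show ?thesis .
  qed
  then show ?thesis
    unfolding polar_volume_def card by (intro arg_cong2[of _ _ _ _ "(/)"] sum.cong) auto
qed

text \<open>Including \<open>{0}\<close>, the neutral element of Minkowski addition, closes the
  class under nonnegative combinations with zero coefficients and under empty sums.\<close>

definition body_or_zero :: "(real^'n) set \<Rightarrow> bool" where
  "body_or_zero X \<longleftrightarrow> convex_body X \<or> X = {0}"

lemma body_or_zero_compact: "body_or_zero X \<Longrightarrow> compact X"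
  by (auto simp: body_or_zero_def convex_body_def)

lemma convex_body_add:
  fixes X Y :: "(real^'n) set"
  assumes "convex_body X" "convex_body Y"
  shows "convex_body (X + Y)"
proof -
  obtain y where y: "y \<in> Y"
    using assms interior_subset by (fastforce simp: convex_body_def)
  have "(+) y ` interior X \<subseteq> interior (X + Y)"
    using y interior_subset[of X] by (intro interior_maximal open_translation) (auto simp: add.commute intro: set_plus_intro)
  then show ?thesis
    using assms unfolding convex_body_def by (auto simp: compact_set_plus convex_set_plus)
qed

lemma convex_body_scale:
  assumes "convex_body (X :: (real^'n) set)" "c \<noteq> 0"
  shows "convex_body ((*\<^sub>R) c ` X)"
proof -
  have "interior ((*\<^sub>R) c ` X) = (*\<^sub>R) c ` interior X"
    using assms(2) by (intro interior_injective_linear_image) (auto simp: inj_on_def)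
  then show ?thesis
    using assms unfolding convex_body_def by (auto simp: compact_scaling convex_scaling)
qed

lemma body_or_zero_add:
  assumes "body_or_zero X" "body_or_zero Y"
  shows "body_or_zero (X + Y)"
  using assms unfolding body_or_zero_def set_zero[symmetric] by (auto intro: convex_body_add)

lemma body_or_zero_scale:
  assumes "body_or_zero X" "c \<ge> 0"
  shows "body_or_zero ((*\<^sub>R) c ` X)"
proof (cases "c = 0")
  case True
  have "X \<noteq> {}" using assms by (auto simp: body_or_zero_def convex_body_def)
  then show ?thesis using True by (auto simp: body_or_zero_def)
qed (use assms in \<open>auto simp: body_or_zero_def convex_body_scale\<close>)

lemma body_or_zero_sum:
  assumes "\<And>i. i \<in> S \<Longrightarrow> body_or_zero (X i)"
  shows "body_or_zero (\<Sum>i\<in>S. X i)"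
  using assms
  by (induction S rule: infinite_finite_induct) (auto simp: body_or_zero_add, auto simp: body_or_zero_def set_zero)

lemma body_or_zero_relabel_hessian:
  fixes \<beta> :: "'m::{finite,wellorder} \<Rightarrow> 'n::finite"
  assumes "bij \<beta>" "body_or_zero X"
  shows "\<exists>H. hessian_of (relabel \<beta> ` X) H"
  using assms unfolding body_or_zero_def
  by (metis convex_body_relabel hessian_of_exists hessian_of_zero image_empty image_insert linear_0 linear_relabel)

lemma ex_bij_wellordered_index: "\<exists>\<beta> :: 'n::finite wellordered_index \<Rightarrow> 'n. bij \<beta>"
  by (metis card_wellordered_index finite finite_same_card_bij)

text \<open>The integral argument lives on a well-ordered index type; a bijective renaming of
  coordinates preserves polarized volumes and commutes with Minkowski combinations, so linearity
  carries over.\<close>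

lemma polar_volume_linear:
  fixes X Y :: "(real^'n) set"
  assumes len: "length Ks + length Ls + 1 = CARD('n)"
    and body: "\<And>Z. Z \<in> set Ks \<union> set Ls \<union> {X, Y} \<Longrightarrow> body_or_zero Z" and ab: "a \<ge> 0" "b \<ge> 0"
  shows "polar_volume (Ks @ ((*\<^sub>R) a ` X + (*\<^sub>R) b ` Y) # Ls) =
         a * polar_volume (Ks @ X # Ls) + b * polar_volume (Ks @ Y # Ls)"
proof -
  obtain \<beta> :: "'n wellordered_index \<Rightarrow> 'n" where \<beta>: "bij \<beta>"
    using ex_bij_wellordered_index by blast
  let ?r = "(`) (relabel \<beta>)"
  obtain HX HY where H: "hessian_of (?r X) HX" "hessian_of (?r Y) HY"
    using body_or_zero_relabel_hessian[OF \<beta>] body by (metis UnI2 insertI1 insertI2)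
  have slot: "polar_volume (Ks @ Z # Ls) = polar_volume (map ?r Ks @ ?r Z # map ?r Ls)" if "body_or_zero Z" for Z
  proof -
    have "compact K" if "K \<in> set (Ks @ Z # Ls)" for K
      using that body \<open>body_or_zero Z\<close> by (auto intro: body_or_zero_compact)
    then show ?thesis
      using polar_volume_relabel[OF \<beta>, of "Ks @ Z # Ls"] len by simp
  qed
  have scale: "?r ((*\<^sub>R) c ` Z) = (*\<^sub>R) c ` ?r Z" for c Z
    by (simp add: image_image linear_scale[OF linear_relabel])
  have "polar_volume (Ks @ ((*\<^sub>R) a ` X + (*\<^sub>R) b ` Y) # Ls) =
      polar_volume (map ?r Ks @ ((*\<^sub>R) a ` ?r X + (*\<^sub>R) b ` ?r Y) # map ?r Ls)"
    using body ab by (subst slot)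
      (auto simp: image_set_plus[OF linear_relabel] scale intro!: body_or_zero_add body_or_zero_scale)
  also have "\<dots> = a * polar_volume (map ?r Ks @ ?r X # map ?r Ls) + b * polar_volume (map ?r Ks @ ?r Y # map ?r Ls)"
    by (rule polar_volume_linear_hessian_of[OF _ _ H ab])
      (use len body in \<open>auto simp: card_wellordered_index intro!: body_or_zero_relabel_hessian \<beta>\<close>)
  also have "\<dots> = a * polar_volume (Ks @ X # Ls) + b * polar_volume (Ks @ Y # Ls)"
    using body by (simp add: slot)
  finally show ?thesis .
qed

lemma polar_volume_replicate:
  fixes X :: "(real^'n) set"
  assumes X: "body_or_zero X"
  shows "polar_volume (replicate CARD('n) X) = measure lebesgue X"
proof -
  obtain \<beta> :: "'n wellordered_index \<Rightarrow> 'n" where \<beta>: "bij \<beta>"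
    using ex_bij_wellordered_index by blast
  obtain H where H: "hessian_of (relabel \<beta> ` X) H"
    using body_or_zero_relabel_hessian[OF \<beta> X] by blast
  show ?thesis
    using polar_volume_relabel[OF \<beta>, of "replicate CARD('n) X"] polar_volume_replicate_hessian_of[OF H]
      measure_relabel_image[OF \<beta>, of X] body_or_zero_compact[OF X]
    by (simp add: card_wellordered_index)
qed

section \<open>Minkowski's theorem\<close>

lemma polar_volume_sum:
  fixes M :: "'i \<Rightarrow> (real^'n) set"
  assumes len: "length Ks + length Ls + 1 = CARD('n)"
    and body: "\<And>Z. Z \<in> set Ks \<union> set Ls \<Longrightarrow> body_or_zero Z"
    and J: "finite J" "\<And>i. i \<in> J \<Longrightarrow> body_or_zero (M i)" "\<And>i. i \<in> J \<Longrightarrow> 0 \<le> c i"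
  shows "polar_volume (Ks @ (\<Sum>i\<in>J. (*\<^sub>R) (c i) ` M i) # Ls) = (\<Sum>i\<in>J. c i * polar_volume (Ks @ M i # Ls))"
  using J
proof (induction J rule: finite_induct)
  case empty
  have "body_or_zero {0 :: real^'n}" by (simp add: body_or_zero_def)
  \<comment> \<open>The empty sum is written as a combination of \<open>{0}\<close> with both
    coefficients 0, so that linearity gives the value 0.\<close>
  then have "polar_volume (Ks @ ((*\<^sub>R) 0 ` {0} + (*\<^sub>R) 0 ` {0}) # Ls) = 0"
    using body by (subst polar_volume_linear[OF len]) auto
  then show ?case by (simp add: set_zero)
next
  case (insert i J)
  have "body_or_zero (\<Sum>i\<in>J. (*\<^sub>R) (c i) ` M i)"
    using insert.prems by (intro body_or_zero_sum body_or_zero_scale) auto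
  then have "polar_volume (Ks @ ((*\<^sub>R) (c i) ` M i + (*\<^sub>R) 1 ` (\<Sum>i\<in>J. (*\<^sub>R) (c i) ` M i)) # Ls) =
      c i * polar_volume (Ks @ M i # Ls) + 1 * polar_volume (Ks @ (\<Sum>i\<in>J. (*\<^sub>R) (c i) ` M i) # Ls)"
    using insert.prems body by (intro polar_volume_linear[OF len]) auto
  then show ?case
    using insert by simp
qed

text \<open>One copy of the sum is expanded at a time: \<open>Ls\<close> collects the bodies already
  chosen, and the chosen \<open>M i\<close> is moved to its end before the remaining
  \<open>a\<close> copies are treated.\<close>

lemma polar_volume_expand:
  fixes M :: "nat \<Rightarrow> (real^'n) set"
  assumes M: "\<And>i. i < m \<Longrightarrow> body_or_zero (M i)" and c: "\<And>i. i < m \<Longrightarrow> 0 \<le> c i"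
    and "a + length Ls = CARD('n)" "\<And>Z. Z \<in> set Ls \<Longrightarrow> body_or_zero Z"
  shows "polar_volume (Ls @ replicate a (\<Sum>i<m. (*\<^sub>R) (c i) ` M i)) =
    (\<Sum>is | set is \<subseteq> {..<m} \<and> length is = a. (\<Prod>i\<leftarrow>is. c i) * polar_volume (Ls @ map M is))"
  using assms(3,4)
proof (induction a arbitrary: Ls)
  case 0
  have "{is. set is \<subseteq> {..<m} \<and> length is = 0} = {[]}" by auto
  then show ?case by simp
next
  case (Suc a)
  define C where "C = (\<Sum>i<m. (*\<^sub>R) (c i) ` M i)"
  have C: "body_or_zero C"
    unfolding C_def using M c by (intro body_or_zero_sum body_or_zero_scale) auto
  have "polar_volume (Ls @ replicate (Suc a) C) = polar_volume (Ls @ C # replicate a C)"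
    by simp
  also have "\<dots> = (\<Sum>i<m. c i * polar_volume (Ls @ M i # replicate a C))"
    unfolding C_def[symmetric] using Suc.prems C M c
    by (subst (1) C_def, intro polar_volume_sum) auto
  also have "\<dots> = (\<Sum>i<m. c i * polar_volume ((Ls @ [M i]) @ replicate a C))"
    by simp
  also have "\<dots> = (\<Sum>i<m. c i * (\<Sum>is | set is \<subseteq> {..<m} \<and> length is = a.
      (\<Prod>i\<leftarrow>is. c i) * polar_volume ((Ls @ [M i]) @ map M is)))"
    unfolding C_def using Suc.prems M
    by (intro sum.cong refl arg_cong2[of _ _ _ _ "(*)"] Suc.IH) auto
  also have "\<dots> = (\<Sum>i<m. \<Sum>is | set is \<subseteq> {..<m} \<and> length is = a.
      c i * (\<Prod>i\<leftarrow>is. c i) * polar_volume (Ls @ M i # map M is))"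
    by (simp add: sum_distrib_left mult.assoc)
  also have "\<dots> = (\<Sum>is | set is \<subseteq> {..<m} \<and> length is = a. \<Sum>i<m.
      c i * (\<Prod>i\<leftarrow>is. c i) * polar_volume (Ls @ M i # map M is))"
    by (rule sum.swap)
  also have "\<dots> = (\<Sum>(is, i)\<in>{is. set is \<subseteq> {..<m} \<and> length is = a} \<times> {..<m}.
      c i * (\<Prod>i\<leftarrow>is. c i) * polar_volume (Ls @ M i # map M is))"
    by (rule sum.cartesian_product)
  also have "\<dots> = (\<Sum>is | set is \<subseteq> {..<m} \<and> length is = Suc a. (\<Prod>i\<leftarrow>is. c i) * polar_volume (Ls @ map M is))"
    unfolding lists_length_Suc_eq
    by (subst sum.reindex) (auto simp: inj_on_def intro!: sum.cong)
  finally show ?case by (simp add: C_def)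
qed

lemma is_mixed_volume_polar_volume: "is_mixed_volume (polar_volume :: (real^'n) set list \<Rightarrow> real)"
  unfolding is_mixed_volume_def
proof (intro conjI allI impI)
  fix Ks :: "(real^'n) set list" and c :: "nat \<Rightarrow> real"
  assume asm: "(\<forall>K\<in>set Ks. convex_body K) \<and> (\<forall>i<length Ks. 0 \<le> c i)"
  then have body: "body_or_zero (Ks ! i)" if "i < length Ks" for i
    using that by (simp add: body_or_zero_def)
  have "body_or_zero (\<Sum>i<length Ks. (*\<^sub>R) (c i) ` (Ks ! i))"
    using asm body by (intro body_or_zero_sum body_or_zero_scale) auto
  from polar_volume_replicate[OF this]
  have "measure lebesgue (\<Sum>i<length Ks. (*\<^sub>R) (c i) ` (Ks ! i)) =
      polar_volume ([] @ replicate CARD('n) (\<Sum>i<length Ks. (*\<^sub>R) (c i) ` (Ks ! i)))"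
    by simp
  also have "\<dots> = (\<Sum>is | set is \<subseteq> {..<length Ks} \<and> length is = CARD('n).
      (\<Prod>i\<leftarrow>is. c i) * polar_volume ([] @ map ((!) Ks) is))"
    using asm body by (intro polar_volume_expand) auto
  finally show "measure lebesgue (\<Sum>i<length Ks. (*\<^sub>R) (c i) ` (Ks ! i)) =
      (\<Sum>is | set is \<subseteq> {..<length Ks} \<and> length is = CARD('n).
        (\<Prod>i\<leftarrow>is. c i) * polar_volume (map ((!) Ks) is))"
    by simp
qed (auto intro: polar_volume_permute)

text \<open>The volume formula with 0-1 coefficients expresses the volume of each partial sum
  through values of \<open>V\<close>. Inverting over subsets isolates the tuples that use every
  index, and by symmetry each of them has the value \<open>V Ks\<close>.\<close>

lemma is_mixed_volume_unique:
  fixes V :: "(real^'n) set list \<Rightarrow> real"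
  assumes V: "is_mixed_volume V" and Ks: "length Ks = CARD('n)" "\<And>K. K \<in> set Ks \<Longrightarrow> convex_body K"
  shows "V Ks = polar_volume Ks"
proof -
  let ?n = "CARD('n)"
  define v where "v is = V (map ((!) Ks) is)" for "is"
  define G where "G S = (\<Sum>is | set is \<subseteq> S \<and> length is = ?n. v is)" for S
  define F where "F S = (\<Sum>is | set is = S \<and> length is = ?n. v is)" for S
  have GF: "G S = sum F (Pow S)" if "finite S" for S
  proof -
    have "G S = (\<Sum>T\<in>Pow S. \<Sum>is\<in>{is \<in> {is. set is \<subseteq> S \<and> length is = ?n}. set is = T}. v is)"
      unfolding G_def using that by (intro sum.group[symmetric] finite_lists_length_eq) auto
    also have "\<dots> = sum F (Pow S)"
      unfolding F_def by (intro sum.cong arg_cong2[of _ _ _ _ sum]) auto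
    finally show ?thesis .
  qed
  have vol: "measure lebesgue (\<Sum>i\<in>S. Ks ! i) = G S" if S: "S \<subseteq> {..<?n}" for S
  proof -
    \<comment> \<open>These coefficients delete the bodies outside \<open>S\<close>, because a
      nonempty set scaled by 0 is \<open>{0}\<close>, and they kill every tuple with an entry
      outside \<open>S\<close>.\<close>
    define c :: "nat \<Rightarrow> real" where "c i = of_bool (i \<in> S)" for i
    have c_nonneg: "0 \<le> c i" for i by (simp add: c_def)
    have ne: "Ks ! i \<noteq> {}" if "i < ?n" for i
    proof -
      have "convex_body (Ks ! i)" using that Ks by simp
      then show ?thesis by (auto simp: convex_body_def)
    qed
    have "(\<Sum>i<?n. (*\<^sub>R) (c i) ` (Ks ! i)) = (\<Sum>i<?n. if i \<in> S then Ks ! i else 0)"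
      using ne by (intro sum.cong) (auto simp: c_def set_zero)
    also have "\<dots> = (\<Sum>i\<in>S. Ks ! i)"
      using S by (simp add: sum.If_cases inf.absorb2 del: set_zero)
    finally have "measure lebesgue (\<Sum>i\<in>S. Ks ! i) =
        (\<Sum>is | set is \<subseteq> {..<?n} \<and> length is = ?n. (\<Prod>i\<leftarrow>is. c i) * v is)"
      using V[unfolded is_mixed_volume_def, THEN conjunct2, rule_format, of Ks c] Ks c_nonneg
      by (simp add: v_def)
    also have "\<dots> = G S"
      unfolding G_def
    proof (rule sum.mono_neutral_cong_right)
      show "{is. set is \<subseteq> S \<and> length is = ?n} \<subseteq> {is. set is \<subseteq> {..<?n} \<and> length is = ?n}"
        using S by auto
      show "\<forall>is\<in>{is. set is \<subseteq> {..<?n} \<and> length is = ?n} - {is. set is \<subseteq> S \<and> length is = ?n}.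
          (\<Prod>i\<leftarrow>is. c i) * v is = 0"
        by (auto simp: prod_list_zero_iff c_def)
      fix "is" assume "is \<in> {is. set is \<subseteq> S \<and> length is = ?n}"
      then have "map c is = map (\<lambda>_. 1) is" by (auto simp: c_def)
      then show "(\<Prod>i\<leftarrow>is. c i) * v is = v is" by (simp add: map_replicate_const)
    qed (simp add: finite_lists_length_eq)
    finally show ?thesis .
  qed
  have "fact ?n * polar_volume Ks =
      (\<Sum>S\<in>Pow {..<?n}. (- 1) ^ (?n - card S) * measure lebesgue (\<Sum>i\<in>S. Ks ! i))"
    by (simp add: polar_volume_def)
  also have "\<dots> = (\<Sum>S\<in>Pow {..<?n}. (- 1) ^ (card {..<?n} - card S) * G S)"
    by (intro sum.cong) (auto simp: vol)
  also have "\<dots> = F {..<?n}"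
    by (rule inclusion_exclusion_mobius[symmetric]) (auto simp: GF)
  \<comment> \<open>A tuple of length \<open>n\<close> whose entries exhaust \<open>n\<close>
    indices has no repetition.\<close>
  also have "\<dots> = (\<Sum>is\<in>permutations_of_set {..<?n}. V Ks)"
    unfolding F_def
  proof (rule sum.cong)
    show "{is. set is = {..<?n} \<and> length is = ?n} = permutations_of_set {..<?n}"
      unfolding permutations_of_set_def by (metis (no_types, lifting) card_distinct card_lessThan distinct_card)
    fix "is" assume "is \<in> permutations_of_set {..<?n}"
    then have "distinct is" "set is = set [0..<?n]"
      by (simp_all add: permutations_of_set_def atLeast0LessThan)
    then have "mset is = mset [0..<?n]"
      using set_eq_iff_mset_eq_distinct[of "is" "[0..<?n]"] distinct_upt by blast
    then have "mset (map ((!) Ks) is) = mset (map ((!) Ks) [0..<?n])"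
      by simp
    also have "map ((!) Ks) [0..<?n] = Ks"
      using Ks(1) map_nth by metis
    finally show "v is = V Ks"
      using V Ks unfolding v_def is_mixed_volume_def by blast
  qed
  also have "\<dots> = fact ?n * V Ks"
    by (simp add: card_permutations_of_set)
  finally show ?thesis by simp
qed

lemma mixed_volume_eq_polar_volume:
  fixes Ks :: "(real^'n) set list"
  assumes "length Ks = CARD('n)" "\<And>K. K \<in> set Ks \<Longrightarrow> convex_body K"
  shows "mixed_volume Ks = polar_volume Ks"
  unfolding mixed_volume_def
  using is_mixed_volume_polar_volume is_mixed_volume_unique[OF _ assms] by (intro the_equality) blast+

section \<open>Multilinear extension to differences of support functions\<close>

lemma support_fn_eqI:
  assumes "x \<in> X" "\<And>y. y \<in> X \<Longrightarrow> y \<bullet> u \<le> x \<bullet> u"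
  shows "support_fn X u = x \<bullet> u"
  unfolding support_fn_def using assms by (intro cSup_eq_maximum) auto

lemma support_fn_attained:
  assumes "compact X" "X \<noteq> {}"
  obtains x where "x \<in> X" "\<And>y. y \<in> X \<Longrightarrow> y \<bullet> u \<le> x \<bullet> u" "support_fn X u = x \<bullet> u"
proof -
  have "continuous_on X (\<lambda>x. x \<bullet> u)" by (intro continuous_intros)
  then obtain x where "x \<in> X" "\<And>y. y \<in> X \<Longrightarrow> y \<bullet> u \<le> x \<bullet> u"
    using continuous_attains_sup[OF assms] by blast
  then show thesis using that support_fn_eqI by blast
qed

lemma support_fn_add:
  assumes "compact X" "X \<noteq> {}" "compact Y" "Y \<noteq> {}"
  shows "support_fn (X + Y) u = support_fn X u + support_fn Y u"
proof -
  obtain x y where "x \<in> X" "\<And>z. z \<in> X \<Longrightarrow> z \<bullet> u \<le> x \<bullet> u" "support_fn X u = x \<bullet> u"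
    "y \<in> Y" "\<And>z. z \<in> Y \<Longrightarrow> z \<bullet> u \<le> y \<bullet> u" "support_fn Y u = y \<bullet> u"
    using support_fn_attained[OF assms(1,2)] support_fn_attained[OF assms(3,4)] by metis
  note xy = this
  have "z \<bullet> u \<le> (x + y) \<bullet> u" if "z \<in> X + Y" for z
    using that by (elim set_plus_elim) (simp add: inner_add_left add_mono xy)
  then show ?thesis
    using xy by (subst support_fn_eqI[of "x + y"]) (auto simp: inner_add_left)
qed

lemma support_fn_scale:
  assumes "compact X" "X \<noteq> {}" "c \<ge> 0"
  shows "support_fn ((*\<^sub>R) c ` X) u = c * support_fn X u"
proof -
  obtain x where "x \<in> X" "\<And>y. y \<in> X \<Longrightarrow> y \<bullet> u \<le> x \<bullet> u" "support_fn X u = x \<bullet> u"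
    using support_fn_attained[OF assms(1,2)] by metis
  note x = this
  have "z \<bullet> u \<le> (c *\<^sub>R x) \<bullet> u" if "z \<in> (*\<^sub>R) c ` X" for z
    using that assms(3) by (elim imageE) (simp add: mult_left_mono x)
  then show ?thesis
    using x by (subst support_fn_eqI[of "c *\<^sub>R x"]) auto
qed

lemma support_fn_uminus: "support_fn (uminus ` X) u = support_fn X (- u)"
  by (simp add: support_fn_def image_image)

lemma body_or_zero_nonempty: "body_or_zero X \<Longrightarrow> X \<noteq> {}"
  by (auto simp: body_or_zero_def convex_body_def)

lemma body_or_zero_convex: "body_or_zero X \<Longrightarrow> convex X"
  by (auto simp: body_or_zero_def convex_body_def)

lemma support_fn_sum_scale:
  assumes "finite J" "\<And>i. i \<in> J \<Longrightarrow> body_or_zero (M i)" "\<And>i. i \<in> J \<Longrightarrow> 0 \<le> c i"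
  shows "support_fn (\<Sum>i\<in>J. (*\<^sub>R) (c i) ` M i) u = (\<Sum>i\<in>J. c i * support_fn (M i) u)"
  using assms
proof (induction J rule: finite_induct)
  case empty
  show ?case using support_fn_eqI[of 0 "{0}" u] by simp
next
  case (insert i J)
  have "body_or_zero ((*\<^sub>R) (c i) ` M i)" "body_or_zero (\<Sum>i\<in>J. (*\<^sub>R) (c i) ` M i)"
    using insert.prems by (auto intro: body_or_zero_sum body_or_zero_scale)
  then have "support_fn ((*\<^sub>R) (c i) ` M i + (\<Sum>i\<in>J. (*\<^sub>R) (c i) ` M i)) u =
      support_fn ((*\<^sub>R) (c i) ` M i) u + support_fn (\<Sum>i\<in>J. (*\<^sub>R) (c i) ` M i) u"
    by (intro support_fn_add body_or_zero_compact body_or_zero_nonempty)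
  moreover have "support_fn ((*\<^sub>R) (c i) ` M i) u = c i * support_fn (M i) u"
    using insert.prems by (intro support_fn_scale body_or_zero_compact body_or_zero_nonempty) auto
  ultimately show ?case
    using insert by simp
qed

text \<open>A point of \<open>X\<close> outside \<open>Y\<close> is strictly separated from
  \<open>Y\<close>, so in the separating direction the support function of \<open>X\<close> would
  exceed that of \<open>Y\<close>.\<close>

lemma subset_of_support_fn_le:
  fixes X Y :: "(real^'n) set"
  assumes Y: "compact Y" "convex Y" "Y \<noteq> {}" and X: "compact X"
    and le: "\<And>u. u \<in> sphere 0 1 \<Longrightarrow> support_fn X u \<le> support_fn Y u"
  shows "X \<subseteq> Y"
proof (rule ccontr)
  assume "\<not> X \<subseteq> Y"
  then obtain x where x: "x \<in> X" "x \<notin> Y" by blast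
  then obtain a b where ab: "a \<bullet> x < b" "\<And>y. y \<in> Y \<Longrightarrow> b < a \<bullet> y"
    using separating_hyperplane_closed_point[OF Y(2) compact_imp_closed[OF Y(1)]] by metis
  have a: "a \<noteq> 0" using ab Y(3) by force
  \<comment> \<open>The sign is reversed because the separation puts \<open>Y\<close> on the side of
    larger values of \<open>a\<close>; the length is normalized because the comparison is available
    on the unit sphere.\<close>
  define u where "u = - sgn a"
  have "u \<in> sphere 0 1" using a by (simp add: u_def norm_sgn)
  obtain y where y: "y \<in> Y" "support_fn Y u = y \<bullet> u"
    using support_fn_attained[OF Y(1,3)] by metis
  obtain z where z: "x \<bullet> u \<le> z \<bullet> u" "support_fn X u = z \<bullet> u"
    using support_fn_attained[OF X] x by (metis empty_iff)
  have "x \<bullet> u \<le> y \<bullet> u"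
    using le[OF \<open>u \<in> sphere 0 1\<close>] y z by simp
  then have "a \<bullet> y \<le> a \<bullet> x"
    using a by (simp add: u_def sgn_div_norm inner_commute[of a] divide_le_cancel)
  then show False using ab y by force
qed

lemma eq_of_support_fn_eq:
  fixes X Y :: "(real^'n) set"
  assumes "body_or_zero X" "body_or_zero Y"
    and "\<And>u. u \<in> sphere 0 1 \<Longrightarrow> support_fn X u = support_fn Y u"
  shows "X = Y"
  using assms
  by (intro equalityI subset_of_support_fn_le body_or_zero_compact body_or_zero_convex body_or_zero_nonempty) auto

lemma convex_body_cball: "convex_body (cball (0 :: real^'n) 1)"
  by (simp add: convex_body_def)

text \<open>The unit ball is added to both sides so that no empty sum of bodies occurs.\<close>

lemma combination_eq_diff:
  fixes M :: "nat \<Rightarrow> (real^'n) set" and c :: "nat \<Rightarrow> real"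
  assumes "\<And>k. k < m \<Longrightarrow> convex_body (M k)"
  defines "P \<equiv> cball 0 1 + (\<Sum>k<m. (*\<^sub>R) (max (c k) 0) ` M k)"
    and "N \<equiv> cball 0 1 + (\<Sum>k<m. (*\<^sub>R) (max (- c k) 0) ` M k)"
  shows "convex_body P" "convex_body N"
    "(\<Sum>k<m. c k * support_fn (M k) u) = support_fn P u - support_fn N u"
proof -
  have M: "body_or_zero (M k)" if "k < m" for k
    using assms(1) that by (simp add: body_or_zero_def)
  have B: "body_or_zero (\<Sum>k<m. (*\<^sub>R) (max (d k) 0) ` M k)" for d :: "nat \<Rightarrow> real"
    using M by (intro body_or_zero_sum body_or_zero_scale) auto
  have body: "convex_body (cball 0 1 + X)" if "body_or_zero X" for X :: "(real^'n) set"
    using that convex_body_add[OF convex_body_cball] convex_body_cball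
    unfolding body_or_zero_def set_zero[symmetric] by auto
  show "convex_body P" "convex_body N"
    unfolding P_def N_def by (intro body B)+
  have supp: "support_fn (cball 0 1 + (\<Sum>k<m. (*\<^sub>R) (max (d k) 0) ` M k)) u =
      support_fn (cball 0 1) u + (\<Sum>k<m. max (d k) 0 * support_fn (M k) u)" for d :: "nat \<Rightarrow> real"
    by (subst support_fn_add[OF _ _ body_or_zero_compact[OF B] body_or_zero_nonempty[OF B]])
      (simp_all, intro support_fn_sum_scale, simp_all add: M)
  have "c k = max (c k) 0 - max (- c k) 0" for k by simp
  then show "(\<Sum>k<m. c k * support_fn (M k) u) = support_fn P u - support_fn N u"
    unfolding P_def N_def supp by (metis (mono_tags, lifting) add_diff_cancel_left left_diff_distrib sum.cong sum_subtractf)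
qed

text \<open>Splitting the coefficients by sign turns the relation between support functions into
  equality of two bodies, whose polarized volumes are then expanded. This makes the multilinear
  extension independent of how a function is written as a difference of support functions.\<close>

lemma polar_volume_combination_eq_0:
  fixes M :: "nat \<Rightarrow> (real^'n) set"
  assumes len: "length Ks + length Ls + 1 = CARD('n)"
    and body: "\<And>Z. Z \<in> set Ks \<union> set Ls \<Longrightarrow> convex_body Z"
    and M: "\<And>k. k < m \<Longrightarrow> convex_body (M k)"
    and zero: "\<And>u. u \<in> sphere 0 1 \<Longrightarrow> (\<Sum>k<m. c k * support_fn (M k) u) = 0"
  shows "(\<Sum>k<m. c k * polar_volume (Ks @ M k # Ls)) = 0"
proof -
  define S where "S d = (\<Sum>k<m. (*\<^sub>R) (max (d k) 0) ` M k)" for d :: "nat \<Rightarrow> real"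
  have eq: "cball 0 1 + S c = cball 0 1 + S (\<lambda>k. - c k)"
    using combination_eq_diff[of m M c] M zero
    by (intro eq_of_support_fn_eq) (auto simp: S_def body_or_zero_def)
  have step: "polar_volume (Ks @ (cball 0 1 + S d) # Ls) =
      polar_volume (Ks @ cball 0 1 # Ls) + (\<Sum>k<m. max (d k) 0 * polar_volume (Ks @ M k # Ls))" for d
  proof -
    have Sd: "body_or_zero (S d)"
      unfolding S_def using M by (intro body_or_zero_sum body_or_zero_scale) (auto simp: body_or_zero_def)
    have "polar_volume (Ks @ ((*\<^sub>R) 1 ` cball 0 1 + (*\<^sub>R) 1 ` S d) # Ls) =
      1 * polar_volume (Ks @ cball 0 1 # Ls) + 1 * polar_volume (Ks @ S d # Ls)"
      using body Sd convex_body_cball by (intro polar_volume_linear[OF len]) (auto simp: body_or_zero_def)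
    moreover have "polar_volume (Ks @ S d # Ls) = (\<Sum>k<m. max (d k) 0 * polar_volume (Ks @ M k # Ls))"
      unfolding S_def using body M by (intro polar_volume_sum[OF len]) (auto simp: body_or_zero_def)
    ultimately show ?thesis by simp
  qed
  have "(\<Sum>k<m. max (c k) 0 * polar_volume (Ks @ M k # Ls)) =
      (\<Sum>k<m. max (- c k) 0 * polar_volume (Ks @ M k # Ls))"
    using step[of c] step[of "\<lambda>k. - c k"] unfolding eq by simp
  moreover have "c k * x = max (c k) 0 * x - max (- c k) 0 * x" for k and x :: real
    by (simp add: max_def)
  ultimately show ?thesis
    by (simp add: sum_subtractf)
qed

section \<open>Existence of the multilinear extension\<close>

lemma support_span_eq_diff:
  fixes f :: "real^'n \<Rightarrow> real"
  assumes "f \<in> support_span"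
  shows "\<exists>A B. convex_body A \<and> convex_body B \<and> (\<forall>u\<in>sphere 0 1. f u = support_fn A u - support_fn B u)"
proof -
  obtain m c and A :: "nat \<Rightarrow> (real^'n) set" where A: "\<forall>i<m. convex_body (A i)"
      "\<forall>u\<in>sphere 0 1. f u = (\<Sum>i<m. c i * support_fn (A i) u)"
    using assms unfolding support_span_def by blast
  define P where "P = cball 0 1 + (\<Sum>k<m. (*\<^sub>R) (max (c k) 0) ` A k)"
  define N where "N = cball 0 1 + (\<Sum>k<m. (*\<^sub>R) (max (- c k) 0) ` A k)"
  have "convex_body P \<and> convex_body N \<and> (\<forall>u\<in>sphere 0 1. f u = support_fn P u - support_fn N u)"
    using combination_eq_diff[of m A c] A unfolding P_def N_def by simp
  then show ?thesis by blast
qed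

lemma combination_in_support_span:
  assumes "convex_body A" "convex_body B" "\<And>u. u \<in> sphere 0 1 \<Longrightarrow> f u = a * support_fn A u + b * support_fn B u"
  shows "f \<in> support_span"
  unfolding support_span_def
  by (rule CollectI, rule exI[of _ 2], rule exI[of _ "\<lambda>i. if i = 0 then a else b"],
      rule exI[of _ "\<lambda>i. if i = 0 then A else B"]) (use assms in \<open>auto simp: numeral_2_eq_2\<close>)

lemma support_fn_in_support_span: "convex_body A \<Longrightarrow> support_fn A \<in> support_span"
  by (rule combination_in_support_span[of A A _ 1 0]) auto

text \<open>\<open>P f\<close> and \<open>N f\<close> are meant to be bodies whose support functions
  have difference \<open>f\<close> on the sphere. \<open>Ks\<close> accumulates, in order, the
  bodies chosen for the arguments already processed.\<close>

primrec extend_volume ::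
    "('f \<Rightarrow> (real^'n) set) \<Rightarrow> ('f \<Rightarrow> (real^'n) set) \<Rightarrow> 'f list \<Rightarrow> (real^'n) set list \<Rightarrow> real" where
  "extend_volume P N [] Ks = polar_volume Ks"
| "extend_volume P N (f # fs) Ks = extend_volume P N fs (Ks @ [P f]) - extend_volume P N fs (Ks @ [N f])"

text \<open>The varying body stands before the arguments still to be processed. Processing them only
  appends bodies to \<open>Ls\<close>, until \<open>polar_volume_combination_eq_0\<close>
  applies.\<close>

lemma extend_volume_combination_eq_0:
  fixes M :: "nat \<Rightarrow> (real^'n) set"
  assumes PN: "\<And>f. f \<in> set fs \<Longrightarrow> convex_body (P f) \<and> convex_body (N f)"
    and "length Ks + length Ls + length fs + 1 = CARD('n)"
    and "\<And>Z. Z \<in> set Ks \<union> set Ls \<Longrightarrow> convex_body Z"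
    and M: "\<And>k. k < m \<Longrightarrow> convex_body (M k)"
    and zero: "\<And>u. u \<in> sphere 0 1 \<Longrightarrow> (\<Sum>k<m. c k * support_fn (M k) u) = 0"
  shows "(\<Sum>k<m. c k * extend_volume P N fs (Ks @ M k # Ls)) = 0"
  using assms(1-3)
proof (induction fs arbitrary: Ls)
  case Nil
  then show ?case using polar_volume_combination_eq_0[OF _ _ M zero] by simp
next
  case (Cons f fs)
  have "(\<Sum>k<m. c k * extend_volume P N fs (Ks @ M k # (Ls @ [Q]))) = 0" if "convex_body Q" for Q
    using that Cons.prems by (intro Cons.IH) auto
  from this[of "P f"] this[of "N f"] Cons.prems(1) show ?case
    by (simp add: right_diff_distrib sum_subtractf)
qed

lemma sum_lessThan_6: "(\<Sum>k<6. f k) = f 0 + f 1 + f 2 + f 3 + f 4 + f (5::nat)"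
  by (simp add: eval_nat_numeral)

text \<open>One representation of every function as a difference is fixed. Both required properties
  reduce to linear relations between support functions in a single slot, which are inherited by the
  polarized volumes.\<close>

lemma ex_multilinear_extension: "\<exists>W :: (real^'n \<Rightarrow> real) list \<Rightarrow> real. is_multilinear_extension W"
proof -
  obtain P N :: "(real^'n \<Rightarrow> real) \<Rightarrow> (real^'n) set" where
    body: "\<And>f. f \<in> support_span \<Longrightarrow> convex_body (P f) \<and> convex_body (N f)" and
    diff: "\<And>f u. f \<in> support_span \<Longrightarrow> u \<in> sphere 0 1 \<Longrightarrow> f u = support_fn (P f) u - support_fn (N f) u"
    using support_span_eq_diff by metis
  have base: "extend_volume P N (map support_fn Ls) Ks = polar_volume (Ks @ Ls)"
    if "length Ks + length Ls = CARD('n)" "\<And>Z. Z \<in> set Ks \<union> set Ls \<Longrightarrow> convex_body Z" for Ks Ls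
    using that
  proof (induction Ls arbitrary: Ks)
    case (Cons L Ls)
    have L: "convex_body L" "support_fn L \<in> support_span"
      using Cons.prems by (auto intro: support_fn_in_support_span)
    have "extend_volume P N (map support_fn Ls) (Ks @ [Q]) = polar_volume (Ks @ Q # Ls)" if "convex_body Q" for Q
      using Cons.prems that by (subst Cons.IH) auto
    then have "extend_volume P N (map support_fn (L # Ls)) Ks =
        polar_volume (Ks @ P (support_fn L) # Ls) - polar_volume (Ks @ N (support_fn L) # Ls)"
      using body[OF L(2)] by simp
    \<comment> \<open>The chosen bodies for \<open>support_fn L\<close> may be unrelated to
      \<open>L\<close>, but the first support function minus the second minus that of
      \<open>L\<close> vanishes on the sphere.\<close>
    moreover have "(\<Sum>k<3. [1, - 1, - 1] ! k * polar_volume (Ks @ [P (support_fn L), N (support_fn L), L] ! k # Ls)) = 0"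
      using Cons.prems body[OF L(2)] L(1) diff[OF L(2)]
      by (intro polar_volume_combination_eq_0) (auto simp: numeral_3_eq_3 less_Suc_eq)
    ultimately show ?case
      by (simp add: numeral_3_eq_3)
  qed simp
  have lin: "extend_volume P N (fs @ h # gs) Ks =
      a * extend_volume P N (fs @ p # gs) Ks + b * extend_volume P N (fs @ q # gs) Ks"
    if "length Ks + length fs + length gs + 1 = CARD('n)" "set fs \<union> set gs \<union> {p, q, h} \<subseteq> support_span"
      "\<And>Z. Z \<in> set Ks \<Longrightarrow> convex_body Z" and h: "\<And>u. u \<in> sphere 0 1 \<Longrightarrow> h u = a * p u + b * q u"
    for Ks fs gs p q h a b
    using that(1-3)
  proof (induction fs arbitrary: Ks)
    case Nil
    \<comment> \<open>The relation \<open>h = a * p + b * q\<close>, written through the six bodies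
      that represent the three functions.\<close>
    have "(\<Sum>k<6. [1, - 1, - a, a, - b, b] ! k * extend_volume P N gs (Ks @ [P h, N h, P p, N p, P q, N q] ! k # [])) = 0"
    proof (rule extend_volume_combination_eq_0)
      show "convex_body (P f) \<and> convex_body (N f)" if "f \<in> set gs" for f
        using that Nil.prems body by auto
      show "convex_body ([P h, N h, P p, N p, P q, N q] ! k)" if "k < 6" for k
        using that Nil.prems body nth_mem[of k "[P h, N h, P p, N p, P q, N q]"] by auto
      show "(\<Sum>k<6. [1, - 1, - a, a, - b, b] ! k * support_fn ([P h, N h, P p, N p, P q, N q] ! k) u) = 0"
        if u: "u \<in> sphere 0 1" for u
      proof -
        have "support_fn (P h) u - support_fn (N h) u =
            a * (support_fn (P p) u - support_fn (N p) u) + b * (support_fn (P q) u - support_fn (N q) u)"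
          using diff[OF _ u, of h] diff[OF _ u, of p] diff[OF _ u, of q] h[OF u] Nil.prems by simp
        then show ?thesis
          by (simp add: sum_lessThan_6 algebra_simps)
      qed
    qed (use Nil.prems in auto)
    then show ?case
      by (simp add: sum_lessThan_6 right_diff_distrib)
  next
    case (Cons f fs)
    have "extend_volume P N (fs @ h # gs) (Ks @ [Q]) =
      a * extend_volume P N (fs @ p # gs) (Ks @ [Q]) + b * extend_volume P N (fs @ q # gs) (Ks @ [Q])"
      if "convex_body Q" for Q
      using that Cons.prems by (intro Cons.IH) auto
    from this[of "P f"] this[of "N f"] Cons.prems(2) body[of f] show ?case
      by (simp add: algebra_simps)
  qed
  have "is_multilinear_extension (\<lambda>fs. extend_volume P N fs [])"
    unfolding is_multilinear_extension_def
  proof (intro conjI allI impI)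
    fix Ks :: "(real^'n) set list"
    assume "length Ks = CARD('n) \<and> (\<forall>K\<in>set Ks. convex_body K)"
    then show "extend_volume P N (map support_fn Ks) [] = mixed_volume Ks"
      using base[of "[]" Ks] mixed_volume_eq_polar_volume[of Ks] by auto
  next
    fix fs gs :: "(real^'n \<Rightarrow> real) list" and p q h :: "real^'n \<Rightarrow> real" and a b :: real
    assume asm: "length fs + length gs + 1 = CARD('n) \<and> set fs \<union> set gs \<union> {p, q, h} \<subseteq> support_span \<and>
      (\<forall>u\<in>sphere 0 1. h u = a * p u + b * q u)"
    then show "extend_volume P N (fs @ h # gs) [] =
        a * extend_volume P N (fs @ p # gs) [] + b * extend_volume P N (fs @ q # gs) []"
      by (intro lin) auto
  qed
  then show ?thesis by blast
qed

section \<open>Uniqueness of the multilinear extension\<close>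

lemma multilinear_extension_support_fn:
  fixes W :: "(real^'n \<Rightarrow> real) list \<Rightarrow> real"
  assumes "is_multilinear_extension W" "length Ks = CARD('n)" "\<And>K. K \<in> set Ks \<Longrightarrow> convex_body K"
  shows "W (map support_fn Ks) = mixed_volume Ks"
  using assms(1)[unfolded is_multilinear_extension_def, THEN conjunct1, THEN spec, of Ks] assms(2,3)
  by blast

lemma multilinear_extension_linear:
  fixes W :: "(real^'n \<Rightarrow> real) list \<Rightarrow> real"
  assumes "is_multilinear_extension W" "length fs + length gs + 1 = CARD('n)"
    "set fs \<union> set gs \<union> {p, q, h} \<subseteq> support_span"
    "\<And>u. u \<in> sphere 0 1 \<Longrightarrow> h u = a * p u + b * q u"
  shows "W (fs @ h # gs) = a * W (fs @ p # gs) + b * W (fs @ q # gs)"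
  by (rule assms(1)[unfolded is_multilinear_extension_def, THEN conjunct2, rule_format], intro conjI ballI)
    (rule assms(2-4); assumption?)+

text \<open>Linearity replaces the first remaining function by two support functions, which join
  \<open>Ks\<close>; when none remains, both extensions are the mixed volume.\<close>

lemma multilinear_extension_unique:
  fixes W W' :: "(real^'n \<Rightarrow> real) list \<Rightarrow> real"
  assumes W: "is_multilinear_extension W" and W': "is_multilinear_extension W'"
    and "length Ks + length fs = CARD('n)" "\<And>K. K \<in> set Ks \<Longrightarrow> convex_body K" "set fs \<subseteq> support_span"
  shows "W (map support_fn Ks @ fs) = W' (map support_fn Ks @ fs)"
  using assms(3-5)
proof (induction fs arbitrary: Ks)
  case Nil
  then show ?case using W W' by (simp add: is_multilinear_extension_def)
next
  case (Cons f fs)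
  obtain A B where AB: "convex_body A" "convex_body B"
      "\<And>u. u \<in> sphere 0 1 \<Longrightarrow> f u = support_fn A u - support_fn B u"
    using support_span_eq_diff[of f] Cons.prems by auto
  have *: "U (map support_fn Ks @ f # fs) =
      1 * U (map support_fn Ks @ support_fn A # fs) + (- 1) * U (map support_fn Ks @ support_fn B # fs)"
    if U: "is_multilinear_extension U" for U
  proof -
    have "set (map support_fn Ks) \<union> set fs \<union> {support_fn A, support_fn B, f} \<subseteq> support_span"
      using Cons.prems AB by (auto intro: support_fn_in_support_span)
    then show ?thesis
      using Cons.prems(1) AB(3) by (intro multilinear_extension_linear[OF U]) auto
  qed
  have "W (map support_fn (Ks @ [Q]) @ fs) = W' (map support_fn (Ks @ [Q]) @ fs)" if "convex_body Q" for Q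
    using that Cons.prems by (intro Cons.IH) auto
  from this[OF AB(1)] this[OF AB(2)] show ?case
    by (simp add: *[OF W] *[OF W'])
qed

lemma mixed_volume_fn_eq:
  fixes W :: "(real^'n \<Rightarrow> real) list \<Rightarrow> real"
  assumes "is_multilinear_extension W" "length fs = CARD('n)" "set fs \<subseteq> support_span"
  shows "mixed_volume_fn fs = W fs"
  unfolding mixed_volume_fn_def
proof (rule the_equality)
  show "\<exists>W'. is_multilinear_extension W' \<and> W' fs = W fs"
    using assms(1) by blast
  fix v assume "\<exists>W'. is_multilinear_extension W' \<and> W' fs = v"
  then obtain W' where W': "is_multilinear_extension W'" "W' fs = v" by blast
  then show "v = W fs"
    using multilinear_extension_unique[OF W'(1) assms(1), of "[]" fs] assms(2,3) by simp
qed

section \<open>Krawtchouk polynomials\<close>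

text \<open>The coefficient of \<open>b ^ k\<close> in the product of the two binomial expansions is
  the defining convolution. The homogeneous form permits the substitution \<open>a = 1 + z\<close>,
  \<open>b = 1 - z\<close> and the exchange of the two variables.\<close>

lemma krawtchouk_generating:
  fixes a b :: real
  assumes "j \<le> n"
  shows "(\<Sum>k\<le>n. krawtchouk k j n * a ^ (n - k) * b ^ k) = (a - b) ^ j * (a + b) ^ (n - j)"
proof -
  define p where "p l = real (j choose l) * (- 1) ^ l * a ^ (j - l)" for l
  define q where "q l = real ((n - j) choose l) * a ^ (n - j - l)" for l
  have "(a - b) ^ j = (\<Sum>l\<le>j. p l * b ^ l)"
    using binomial_ring[of "- b" a j] by (simp add: p_def power_minus[of b] mult_ac)
  moreover have "(a + b) ^ (n - j) = (\<Sum>l\<le>n - j. q l * b ^ l)"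
    using binomial_ring[of b a "n - j"] by (simp add: q_def add.commute mult_ac)
  ultimately have "(a - b) ^ j * (a + b) ^ (n - j) = (\<Sum>k\<le>j + (n - j). (\<Sum>l\<le>k. p l * q (k - l)) * b ^ k)"
    by (simp only:) (rule polynomial_product, auto simp: p_def q_def)
  also have "\<dots> = (\<Sum>k\<le>n. krawtchouk k j n * a ^ (n - k) * b ^ k)"
  proof (intro sum.cong arg_cong2[of _ _ _ _ "(*)"] refl)
    fix k assume "k \<in> {..n}"
    have "p l * q (k - l) = (- 1) ^ l * real (j choose l) * real ((n - j) choose (k - l)) * a ^ (n - k)"
      if "l \<le> k" for l
    \<comment> \<open>In the other case a binomial coefficient vanishes on both sides, so the
      truncated subtraction in the exponents does no harm.\<close>
    proof (cases "l \<le> j \<and> k - l \<le> n - j")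
      case True
      then have "j - l + (n - j - (k - l)) = n - k" using that assms by linarith
      then show ?thesis by (simp add: p_def q_def power_add[symmetric] mult_ac)
    qed (auto simp: p_def q_def)
    then show "(\<Sum>l\<le>k. p l * q (k - l)) = krawtchouk k j n * a ^ (n - k)"
      by (simp add: krawtchouk_def sum_distrib_right)
  qed (use assms in auto)
  finally show ?thesis by simp
qed

lemma polyfun_coeff_eqI:
  fixes c d :: "nat \<Rightarrow> real"
  assumes "\<And>x. (\<Sum>i\<le>n. c i * x ^ i) = (\<Sum>i\<le>n. d i * x ^ i)" "i \<le> n"
  shows "c i = d i"
  using assms polyfun_eq_coeffs by blast

text \<open>Reversing the coefficients exchanges the roles of 1 and \<open>z\<close> in the
  generating function, which only changes the sign of the factor \<open>1 - z\<close>, taken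
  \<open>j\<close> times.\<close>

lemma krawtchouk_reflect:
  assumes "j \<le> n" "k \<le> n"
  shows "krawtchouk (n - k) j n = (- 1) ^ j * krawtchouk k j n"
proof -
  have "(\<Sum>k\<le>n. krawtchouk (n - k) j n * z ^ k) = (\<Sum>k\<le>n. ((- 1) ^ j * krawtchouk k j n) * z ^ k)" for z
  proof -
    have "(\<Sum>k\<le>n. krawtchouk (n - k) j n * z ^ k) = (\<Sum>k\<le>n. krawtchouk k j n * z ^ (n - k) * 1 ^ k)"
      by (rule sum.reindex_bij_witness[of _ "\<lambda>k. n - k" "\<lambda>k. n - k"]) auto
    also have "\<dots> = (z - 1) ^ j * (z + 1) ^ (n - j)"
      by (rule krawtchouk_generating[OF assms(1)])
    also have "\<dots> = (- 1) ^ j * ((1 - z) ^ j * (1 + z) ^ (n - j))"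
      by (simp add: power_mult_distrib[symmetric] mult.assoc[symmetric] add.commute)
    also have "\<dots> = (- 1) ^ j * (\<Sum>k\<le>n. krawtchouk k j n * 1 ^ (n - k) * z ^ k)"
      by (simp only: krawtchouk_generating[OF assms(1)])
    finally show ?thesis by (simp add: sum_distrib_left mult.assoc)
  qed
  from polyfun_coeff_eqI[OF this assms(2)] show ?thesis .
qed

text \<open>The Krawtchouk matrix is its own inverse up to \<open>2 ^ n\<close>: summing over
  \<open>i\<close> and then applying the generating function with \<open>1 + z\<close> and
  \<open>1 - z\<close> gives \<open>(2 * z) ^ j * 2 ^ (n - j)\<close>, a single monomial.\<close>

lemma krawtchouk_orthogonal:
  assumes "j \<le> n" "i \<le> n"
  shows "(\<Sum>k\<le>n. krawtchouk k j n * krawtchouk i k n) = (if i = j then 2 ^ n else 0)"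
proof -
  have "(\<Sum>i\<le>n. (\<Sum>k\<le>n. krawtchouk k j n * krawtchouk i k n) * z ^ i) =
        (\<Sum>i\<le>n. (if i = j then 2 ^ n else 0) * z ^ i)" for z :: real
  proof -
    have "(\<Sum>i\<le>n. (\<Sum>k\<le>n. krawtchouk k j n * krawtchouk i k n) * z ^ i) =
        (\<Sum>k\<le>n. krawtchouk k j n * (\<Sum>i\<le>n. krawtchouk i k n * 1 ^ (n - i) * z ^ i))"
      by (simp add: sum_distrib_left sum_distrib_right mult.assoc) (rule sum.swap)
    also have "\<dots> = (\<Sum>k\<le>n. krawtchouk k j n * ((1 - z) ^ k * (1 + z) ^ (n - k)))"
      by (intro sum.cong) (simp_all only: krawtchouk_generating atMost_iff)
    also have "\<dots> = (\<Sum>k\<le>n. krawtchouk k j n * (1 + z) ^ (n - k) * (1 - z) ^ k)"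
      by (simp add: mult_ac)
    also have "\<dots> = (2 * z) ^ j * 2 ^ (n - j)"
      by (subst krawtchouk_generating[OF assms(1)]) simp
    also have "\<dots> = 2 ^ n * z ^ j"
      using assms(1) by (simp add: power_mult_distrib power_add[symmetric])
    also have "\<dots> = (\<Sum>i\<le>n. (if i = j then 2 ^ n else 0) * z ^ i)"
      using assms(1) by (simp add: if_distrib[of "\<lambda>x. x * _"] cong: if_cong)
    finally show ?thesis .
  qed
  from polyfun_coeff_eqI[OF this assms(2)] show ?thesis .
qed

text \<open>The two-variable generating function is the \<open>n\<close>-th power of
  \<open>1 + x + y - x * y\<close>, which is symmetric in \<open>x\<close> and
  \<open>y\<close>.\<close>

lemma krawtchouk_symmetry:
  assumes "j \<le> n" "k \<le> n"
  shows "real (n choose k) * krawtchouk j k n = real (n choose j) * krawtchouk k j n"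
proof -
  have gen: "(\<Sum>k\<le>n. (\<Sum>j\<le>n. real (n choose k) * krawtchouk j k n * y ^ j) * x ^ k) = ((1 + y) + (1 - y) * x) ^ n"
    for x y :: real
  proof -
    have "((1 + y) + (1 - y) * x) ^ n = (\<Sum>k\<le>n. real (n choose k) * ((1 - y) * x) ^ k * (1 + y) ^ (n - k))"
      using binomial_ring[of "(1 - y) * x" "1 + y" n] by (simp add: add.commute)
    also have "\<dots> = (\<Sum>k\<le>n. real (n choose k) * ((1 - y) ^ k * (1 + y) ^ (n - k)) * x ^ k)"
      by (simp add: power_mult_distrib mult_ac)
    also have "\<dots> = (\<Sum>k\<le>n. real (n choose k) * (\<Sum>j\<le>n. krawtchouk j k n * 1 ^ (n - j) * y ^ j) * x ^ k)"
      by (intro sum.cong) (simp_all only: krawtchouk_generating atMost_iff)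
    finally show ?thesis by (simp add: sum_distrib_left mult.assoc)
  qed
  have "(\<Sum>k\<le>n. (\<Sum>j\<le>n. real (n choose k) * krawtchouk j k n * y ^ j) * x ^ k) =
        (\<Sum>k\<le>n. (\<Sum>j\<le>n. real (n choose j) * krawtchouk k j n * y ^ j) * x ^ k)" for x y :: real
  proof -
    have "(\<Sum>k\<le>n. (\<Sum>j\<le>n. real (n choose j) * krawtchouk k j n * y ^ j) * x ^ k) =
        (\<Sum>j\<le>n. (\<Sum>k\<le>n. real (n choose j) * krawtchouk k j n * x ^ k) * y ^ j)"
      unfolding sum_distrib_right by (subst sum.swap) (simp add: mult_ac)
    also have "\<dots> = ((1 + y) + (1 - y) * x) ^ n"
      unfolding gen by (simp add: algebra_simps)
    finally show ?thesis by (simp add: gen)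
  qed
  from polyfun_coeff_eqI[OF this assms(2)]
  show ?thesis
    by (rule polyfun_coeff_eqI[OF _ assms(1)])
qed

lemma sum_atMost_even:
  fixes f :: "nat \<Rightarrow> real"
  assumes "\<And>k. k \<le> n \<Longrightarrow> odd k \<Longrightarrow> f k = 0"
  shows "(\<Sum>k\<le>n. f k) = (\<Sum>r\<le>n div 2. f (2 * r))"
proof -
  have "(\<Sum>k\<le>n. f k) = (\<Sum>k | k \<le> n \<and> even k. f k)"
    using assms by (intro sum.mono_neutral_right) auto
  also have "\<dots> = (\<Sum>r\<le>n div 2. f (2 * r))"
    by (rule sum.reindex_bij_witness[of _ "\<lambda>r. 2 * r" "\<lambda>k. k div 2"]) auto
  finally show ?thesis .
qed

section \<open>Mixed volumes of a body and its reflection\<close>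

lemma polar_volume_uminus:
  fixes Ks :: "(real^'n) set list"
  assumes "length Ks = CARD('n)"
  shows "polar_volume (map ((`) uminus) Ks) = polar_volume Ks"
proof -
  have lin: "linear (uminus :: real^'n \<Rightarrow> real^'n)"
    by (rule linearI) auto
  have "measure lebesgue (\<Sum>i\<in>S. map ((`) uminus) Ks ! i) = measure lebesgue (\<Sum>i\<in>S. Ks ! i)"
    if "S \<subseteq> {..<CARD('n)}" for S
  proof -
    have "(\<Sum>i\<in>S. map ((`) uminus) Ks ! i) = (\<Sum>i\<in>S. uminus ` (Ks ! i))"
      using that assms by (intro sum.cong) auto
    also have "\<dots> = (\<lambda>x. 0 + (- 1) *\<^sub>R x) ` (\<Sum>i\<in>S. Ks ! i)"
      by (simp add: image_set_sum[OF lin])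
    also have "measure lebesgue \<dots> = measure lebesgue (\<Sum>i\<in>S. Ks ! i)"
      using measure_lebesgue_affine[of "- 1" 0] by simp
    finally show ?thesis .
  qed
  then show ?thesis
    unfolding polar_volume_def by (intro arg_cong2[of _ _ _ _ "(/)"] sum.cong) auto
qed

lemma convex_body_uminus: "convex_body K \<Longrightarrow> convex_body (uminus ` K)"
  using convex_body_scale[of K "- 1"] by (simp add: scaleR_minus1_left[abs_def])

lemma G_mixed_eq_polar_volume:
  fixes K :: "(real^'n) set"
  assumes "convex_body K" "j \<le> CARD('n)"
  shows "G_mixed K j = polar_volume (replicate j (uminus ` K) @ replicate (CARD('n) - j) K)"
  unfolding G_mixed_def using assms by (intro mixed_volume_eq_polar_volume) (auto simp: convex_body_uminus)

text \<open>Reflecting all \<open>n\<close> arguments at once exchanges \<open>K\<close> and its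
  reflection without changing any volume.\<close>

lemma G_mixed_reflect:
  fixes K :: "(real^'n) set"
  assumes K: "convex_body K" and j: "j \<le> CARD('n)"
  shows "G_mixed K (CARD('n) - j) = G_mixed K j"
proof -
  have "G_mixed K (CARD('n) - j) = polar_volume (replicate (CARD('n) - j) (uminus ` K) @ replicate j K)"
    using j by (subst G_mixed_eq_polar_volume[OF K]) auto
  also have "\<dots> = polar_volume (map ((`) uminus) (replicate (CARD('n) - j) (uminus ` K) @ replicate j K))"
    using j by (intro polar_volume_uminus[symmetric]) simp
  also have "\<dots> = polar_volume (replicate (CARD('n) - j) K @ replicate j (uminus ` K))"
    by (simp add: image_image)
  also have "\<dots> = polar_volume (replicate j (uminus ` K) @ replicate (CARD('n) - j) K)"
    using j by (intro polar_volume_permute) auto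
  also have "\<dots> = G_mixed K j"
    using j by (simp add: G_mixed_eq_polar_volume[OF K])
  finally show ?thesis .
qed

section \<open>Expansion into the mixed volumes of a body and its reflection\<close>

lemma mset_map_bool:
  "mset (map f bs) = replicate_mset (length (filter id bs)) (f True) + replicate_mset (length (filter Not bs)) (f False)"
  by (induction bs) (auto split: bool.splits)

lemma degree_prod_list_linear_le:
  "degree (\<Prod>(a, b)\<leftarrow>ps. [:a, b:] :: real poly) \<le> length ps"
proof (induction ps)
  case (Cons p ps)
  obtain a b where p: "p = (a, b)" by force
  have "degree ([:a, b:] * (\<Prod>(a, b)\<leftarrow>ps. [:a, b:])) \<le> 1 + length ps"
    by (rule order_trans[OF degree_mult_le], rule add_mono) (use Cons in \<open>auto simp: degree_pCons_le\<close>)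
  then show ?case by (simp add: p del: mult_pCons_left)
qed simp

text \<open>Under the linear functional that sends the \<open>k\<close>-th power of the variable to
  \<open>g k\<close>, multiplication by the variable becomes a shift of \<open>g\<close>. This is
  the effect of expanding one more argument.\<close>

lemma sum_coeff_linear_mult:
  fixes q :: "real poly"
  assumes "degree q \<le> m"
  shows "(\<Sum>k\<le>Suc m. coeff ([:a, b:] * q) k * g k) =
    a * (\<Sum>k\<le>m. coeff q k * g k) + b * (\<Sum>k\<le>m. coeff q k * g (Suc k))"
proof -
  have "(\<Sum>k\<le>Suc m. coeff ([:a, b:] * q) k * g k) =
      (\<Sum>k\<le>Suc m. a * (coeff q k * g k)) + (\<Sum>k\<le>Suc m. coeff (pCons 0 (smult b q)) k * g k)"
    by (simp add: sum.distrib[symmetric] distrib_right mult.assoc del: sum.atMost_Suc)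
  also have "(\<Sum>k\<le>Suc m. a * (coeff q k * g k)) = a * (\<Sum>k\<le>m. coeff q k * g k)"
    using assms by (simp add: coeff_eq_0 sum_distrib_left)
  also have "(\<Sum>k\<le>Suc m. coeff (pCons 0 (smult b q)) k * g k) = b * (\<Sum>k\<le>m. coeff q k * g (Suc k))"
    by (subst sum.atMost_Suc_shift) (simp add: sum_distrib_left mult.assoc)
  finally show ?thesis .
qed

text \<open>A variable marks the slots that receive the reflected body, so each argument becomes the
  linear polynomial \<open>[:a, b:]\<close> and the coefficient with index \<open>k\<close> collects
  the choices with \<open>k\<close> reflections. \<open>bs\<close> records the slots already
  decided; only the number of its reflections matters, by symmetry.\<close>

lemma multilinear_extension_expand:
  fixes K :: "(real^'n) set"
  assumes W: "is_multilinear_extension W" and K: "convex_body K"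
    and "length bs + length ps = CARD('n)"
  shows "W (map (\<lambda>b. support_fn (if b then uminus ` K else K)) bs @
            map (\<lambda>(a, b) u. a * support_fn K u + b * support_fn (uminus ` K) u) ps) =
         (\<Sum>k\<le>length ps. coeff (\<Prod>(a, b)\<leftarrow>ps. [:a, b:]) k * G_mixed K (length (filter id bs) + k))"
  using assms(3)
proof (induction ps arbitrary: bs)
  case Nil
  let ?f = "\<lambda>b. if b then uminus ` K else K"
  have "W (map (\<lambda>b. support_fn (?f b)) bs) = W (map support_fn (map ?f bs))"
    by (simp add: comp_def)
  also have "\<dots> = mixed_volume (map ?f bs)"
    using Nil K convex_body_uminus[OF K] by (intro multilinear_extension_support_fn[OF W]) auto
  also have "\<dots> = polar_volume (map ?f bs)"
    using Nil K convex_body_uminus[OF K] by (intro mixed_volume_eq_polar_volume) auto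
  also have "\<dots> = polar_volume (replicate (length (filter id bs)) (uminus ` K) @
      replicate (CARD('n) - length (filter id bs)) K)"
  proof (rule polar_volume_permute)
    have "length (filter Not bs) = CARD('n) - length (filter id bs)"
      using Nil sum_length_filter_compl[of id bs] by (simp add: comp_def)
    then show "mset (map ?f bs) = mset (replicate (length (filter id bs)) (uminus ` K) @
        replicate (CARD('n) - length (filter id bs)) K)"
      unfolding mset_map_bool by simp
    show "length (replicate (length (filter id bs)) (uminus ` K) @
        replicate (CARD('n) - length (filter id bs)) K) = CARD('n)"
      using Nil length_filter_le[of id bs] by simp
  qed
  also have "\<dots> = G_mixed K (length (filter id bs))"
    using Nil length_filter_le[of id bs] by (intro G_mixed_eq_polar_volume[symmetric] K) simp
  finally show ?case by (simp add: id_def)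
next
  case (Cons p ps)
  obtain a b where p: "p = (a, b)" by force
  define F where "F = map (\<lambda>b. support_fn (if b then uminus ` K else K)) bs"
  define L where "L = map (\<lambda>(a, b) u. a * support_fn K u + b * support_fn (uminus ` K) u) ps"
  define q where "q = (\<Prod>(a, b)\<leftarrow>ps. [:a, b:])"
  have mK: "convex_body (uminus ` K)" by (rule convex_body_uminus[OF K])
  have span: "(\<lambda>u. a * support_fn K u + b * support_fn (uminus ` K) u) \<in> support_span" for a b
    by (rule combination_in_support_span[OF K mK]) simp
  have "W (F @ (\<lambda>u. a * support_fn K u + b * support_fn (uminus ` K) u) # L) =
      a * W (F @ support_fn K # L) + b * W (F @ support_fn (uminus ` K) # L)"
  proof -
    have "set F \<union> set L \<union> {support_fn K, support_fn (uminus ` K), \<lambda>u. a * support_fn K u + b * support_fn (uminus ` K) u}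
        \<subseteq> support_span"
      using span K mK by (auto simp: F_def L_def support_fn_in_support_span)
    moreover have "length F + length L + 1 = CARD('n)"
      using Cons.prems by (simp add: F_def L_def)
    ultimately show ?thesis
      by (intro multilinear_extension_linear[OF W]) auto
  qed
  also have "W (F @ support_fn K # L) = (\<Sum>k\<le>length ps. coeff q k * G_mixed K (length (filter id bs) + k))"
    using Cons.IH[of "bs @ [False]"] Cons.prems by (simp add: F_def L_def q_def id_def)
  also have "W (F @ support_fn (uminus ` K) # L) = (\<Sum>k\<le>length ps. coeff q k * G_mixed K (length (filter id bs) + Suc k))"
    using Cons.IH[of "bs @ [True]"] Cons.prems by (simp add: F_def L_def q_def id_def)
  also have "a * (\<Sum>k\<le>length ps. coeff q k * G_mixed K (length (filter id bs) + k)) +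
      b * (\<Sum>k\<le>length ps. coeff q k * G_mixed K (length (filter id bs) + Suc k)) =
      (\<Sum>k\<le>Suc (length ps). coeff ([:a, b:] * q) k * G_mixed K (length (filter id bs) + k))"
    unfolding q_def by (intro sum_coeff_linear_mult[symmetric] degree_prod_list_linear_le)
  finally show ?case
    by (simp add: p F_def L_def q_def id_def del: sum.atMost_Suc)
qed

lemma coeff_eq_if_poly_eq:
  fixes p :: "real poly"
  assumes "\<And>z. poly p z = (\<Sum>j\<le>n. c j * z ^ j)" "j \<le> n"
  shows "coeff p j = c j"
proof -
  have "poly p = poly (\<Sum>j\<le>n. monom (c j) j)"
    by (simp add: fun_eq_iff assms(1) poly_sum poly_monom)
  then have "p = (\<Sum>j\<le>n. monom (c j) j)"
    by (simp add: poly_eq_poly_eq_iff)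
  then show ?thesis
    using assms(2) by (simp add: coeff_sum sum.delta)
qed

text \<open>The even part becomes the polynomial \<open>(1 + z) / 2\<close> and the odd part
  \<open>(1 - z) / 2\<close>; their product is the Krawtchouk generating function divided by
  \<open>2 ^ n\<close>.\<close>

lemma mixed_volume_fn_even_odd:
  fixes K :: "(real^'n) set"
  assumes K: "convex_body K" and k: "k \<le> CARD('n)"
  shows "mixed_volume_fn (replicate (CARD('n) - k) (even_part K) @ replicate k (odd_part K)) =
    (\<Sum>j\<le>CARD('n). krawtchouk j k CARD('n) * G_mixed K j) / 2 ^ CARD('n)"
proof -
  let ?n = "CARD('n)"
  obtain W :: "(real^'n \<Rightarrow> real) list \<Rightarrow> real" where W: "is_multilinear_extension W"
    using ex_multilinear_extension by blast
  define ps :: "(real \<times> real) list" where "ps = replicate (?n - k) (1/2, 1/2) @ replicate k (1/2, - 1/2)"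
  define q where "q = (\<Prod>(a, b)\<leftarrow>ps. [:a, b:])"
  have len: "length ps = ?n" using k by (simp add: ps_def)
  have even: "even_part K = (\<lambda>u. 1/2 * support_fn K u + 1/2 * support_fn (uminus ` K) u)"
    and odd: "odd_part K = (\<lambda>u. 1/2 * support_fn K u + - 1/2 * support_fn (uminus ` K) u)"
    by (simp_all add: fun_eq_iff even_part_def odd_part_def support_fn_uminus field_simps)
  have span: "even_part K \<in> support_span" "odd_part K \<in> support_span"
    by (rule combination_in_support_span[OF K convex_body_uminus[OF K], where a = "1/2" and b = "1/2"],
        simp add: even)
      (rule combination_in_support_span[OF K convex_body_uminus[OF K], where a = "1/2" and b = "- 1/2"],
        simp add: odd)
  have lst: "replicate (?n - k) (even_part K) @ replicate k (odd_part K) =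
      map (\<lambda>(a, b) u. a * support_fn K u + b * support_fn (uminus ` K) u) ps"
    by (simp add: ps_def even odd)
  have "mixed_volume_fn (replicate (?n - k) (even_part K) @ replicate k (odd_part K)) =
      W (replicate (?n - k) (even_part K) @ replicate k (odd_part K))"
    using k span by (intro mixed_volume_fn_eq[OF W]) auto
  also have "\<dots> = (\<Sum>j\<le>?n. coeff q j * G_mixed K j)"
    using multilinear_extension_expand[OF W K, of "[]" ps] len by (simp add: lst q_def)
  also have "\<dots> = (\<Sum>j\<le>?n. (krawtchouk j k ?n / 2 ^ ?n) * G_mixed K j)"
  proof (intro sum.cong arg_cong2[of _ _ _ _ "(*)"] refl)
    fix j assume "j \<in> {..?n}"
    have "poly q z = (\<Sum>j\<le>?n. (krawtchouk j k ?n / 2 ^ ?n) * z ^ j)" for z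
    proof -
      have "poly q z = ((1 + z) / 2) ^ (?n - k) * ((1 - z) / 2) ^ k"
        by (simp add: q_def ps_def add_divide_distrib diff_divide_distrib)
      also have "\<dots> = (1 - z) ^ k * (1 + z) ^ (?n - k) / 2 ^ ?n"
        using k by (simp add: power_divide power_add[symmetric])
      also have "\<dots> = (\<Sum>j\<le>?n. krawtchouk j k ?n * 1 ^ (?n - j) * z ^ j) / 2 ^ ?n"
        by (simp only: krawtchouk_generating[OF k])
      finally show ?thesis by (simp add: sum_divide_distrib)
    qed
    then show "coeff q j = krawtchouk j k ?n / 2 ^ ?n"
      using \<open>j \<in> {..?n}\<close> by (intro coeff_eq_if_poly_eq) auto
  qed
  finally show ?thesis by (simp add: sum_divide_distrib)
qed

text \<open>Replacing \<open>j\<close> by \<open>n - j\<close> preserves \<open>G_mixed\<close> and,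
  for odd \<open>k\<close>, reverses the sign of the Krawtchouk factor, so the sum equals its own
  negative.\<close>

lemma mixed_volume_fn_odd_eq_0:
  fixes K :: "(real^'n) set"
  assumes K: "convex_body K" and k: "k \<le> CARD('n)" "odd k"
  shows "mixed_volume_fn (replicate (CARD('n) - k) (even_part K) @ replicate k (odd_part K)) = 0"
proof -
  let ?n = "CARD('n)"
  have "(\<Sum>j\<le>?n. krawtchouk j k ?n * G_mixed K j) = (\<Sum>j\<le>?n. krawtchouk (?n - j) k ?n * G_mixed K (?n - j))"
    by (rule sum.reindex_bij_witness[of _ "\<lambda>j. ?n - j" "\<lambda>j. ?n - j"]) auto
  also have "\<dots> = (\<Sum>j\<le>?n. - (krawtchouk j k ?n * G_mixed K j))"
    using k by (intro sum.cong) (auto simp: krawtchouk_reflect G_mixed_reflect[OF K])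
  finally have "(\<Sum>j\<le>?n. krawtchouk j k ?n * G_mixed K j) = 0"
    by (simp add: sum_negf)
  then show ?thesis
    by (simp add: mixed_volume_fn_even_odd[OF K k(1)])
qed

section \<open>Volume along the path between a body and its reflection\<close>

lemma convex_body_body_path:
  fixes K :: "(real^'n) set"
  assumes K: "convex_body K" and t: "- 1 \<le> t" "t \<le> 1"
  shows "convex_body (body_path K t)"
proof -
  have "body_or_zero ((*\<^sub>R) ((1 - t) / 2) ` uminus ` K)" "body_or_zero ((*\<^sub>R) ((1 + t) / 2) ` K)"
    using K t convex_body_uminus[OF K] by (intro body_or_zero_scale; simp add: body_or_zero_def)+
  \<comment> \<open>At an end of the path one summand degenerates to \<open>{0}\<close>, but the two
    coefficients never vanish together.\<close>
  moreover have "(1 + t) / 2 \<noteq> 0 \<or> (1 - t) / 2 \<noteq> 0"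
    by auto
  then have "convex_body ((*\<^sub>R) ((1 - t) / 2) ` uminus ` K) \<or> convex_body ((*\<^sub>R) ((1 + t) / 2) ` K)"
    using convex_body_scale[OF K, of "(1 + t) / 2"] convex_body_scale[OF convex_body_uminus[OF K], of "(1 - t) / 2"]
    by blast
  ultimately show ?thesis
    unfolding body_path_def body_or_zero_def set_zero[symmetric] by (auto intro: convex_body_add)
qed

text \<open>The volume is the mixed volume at \<open>n\<close> equal arguments. Each has support
  function \<open>a\<close> times that of \<open>K\<close> plus \<open>b\<close> times that of the
  reflection, so the marking polynomial is the \<open>n\<close>-th power of
  \<open>a + b * z\<close>.\<close>

lemma measure_body_path:
  fixes K :: "(real^'n) set"
  assumes K: "convex_body K" and t: "- 1 \<le> t" "t \<le> 1"
  shows "measure lebesgue (body_path K t) =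
    1 / 2 ^ CARD('n) * (\<Sum>j\<le>CARD('n). real (CARD('n) choose j) * (1 + t) ^ (CARD('n) - j) * (1 - t) ^ j * G_mixed K j)"
proof -
  let ?n = "CARD('n)"
  define a where "a = (1 + t) / 2"
  define b where "b = (1 - t) / 2"
  obtain W :: "(real^'n \<Rightarrow> real) list \<Rightarrow> real" where W: "is_multilinear_extension W"
    using ex_multilinear_extension by blast
  have ab: "a \<ge> 0" "b \<ge> 0" using t by (auto simp: a_def b_def)
  have bp: "convex_body (body_path K t)"
    by (rule convex_body_body_path[OF K t])
  have "support_fn (body_path K t) = (\<lambda>u. a * support_fn K u + b * support_fn (uminus ` K) u)"
  proof
    fix u
    have b0: "body_or_zero K" "body_or_zero (uminus ` K)"
      using K by (auto simp: body_or_zero_def convex_body_uminus)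
    show "support_fn (body_path K t) u = a * support_fn K u + b * support_fn (uminus ` K) u"
      unfolding body_path_def a_def[symmetric] b_def[symmetric]
      by (subst support_fn_add, (intro body_or_zero_compact body_or_zero_nonempty body_or_zero_scale b0 ab)+,
          subst (1 2) support_fn_scale, (intro body_or_zero_compact body_or_zero_nonempty b0 ab refl)+)
  qed
  then have lst: "map support_fn (replicate ?n (body_path K t)) =
      map (\<lambda>(a, b) u. a * support_fn K u + b * support_fn (uminus ` K) u) (replicate ?n (a, b))"
    by simp
  define q where "q = (\<Prod>(a, b)\<leftarrow>replicate ?n (a, b). [:a, b:])"
  have "measure lebesgue (body_path K t) = polar_volume (replicate ?n (body_path K t))"
    using bp by (intro polar_volume_replicate[symmetric]) (simp add: body_or_zero_def)
  also have "\<dots> = mixed_volume (replicate ?n (body_path K t))"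
    using bp by (intro mixed_volume_eq_polar_volume[symmetric]) auto
  also have "\<dots> = W (map support_fn (replicate ?n (body_path K t)))"
    using bp by (intro multilinear_extension_support_fn[OF W, symmetric]) auto
  also have "\<dots> = (\<Sum>j\<le>?n. coeff q j * G_mixed K j)"
    using multilinear_extension_expand[OF W K, of "[]" "replicate ?n (a, b)"] unfolding lst q_def by simp
  also have "\<dots> = (\<Sum>j\<le>?n. (real (?n choose j) * a ^ (?n - j) * b ^ j) * G_mixed K j)"
  proof (intro sum.cong arg_cong2[of _ _ _ _ "(*)"] refl)
    fix j assume j: "j \<in> {..?n}"
    have "poly q z = (\<Sum>j\<le>?n. (real (?n choose j) * a ^ (?n - j) * b ^ j) * z ^ j)" for z
    proof -
      have "poly q z = (b * z + a) ^ ?n"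
        by (simp add: q_def add.commute mult.commute)
      also have "\<dots> = (\<Sum>j\<le>?n. real (?n choose j) * (b * z) ^ j * a ^ (?n - j))"
        by (rule binomial_ring)
      finally show ?thesis by (simp add: power_mult_distrib mult_ac)
    qed
    then show "coeff q j = real (?n choose j) * a ^ (?n - j) * b ^ j"
      using j by (intro coeff_eq_if_poly_eq) auto
  qed
  also have "\<dots> = (\<Sum>j\<le>?n. 1 / 2 ^ ?n * (real (?n choose j) * (1 + t) ^ (?n - j) * (1 - t) ^ j * G_mixed K j))"
  proof (rule sum.cong)
    fix j assume "j \<in> {..?n}"
    then have "(2::real) ^ ?n = 2 ^ (?n - j) * 2 ^ j" by (simp add: power_add[symmetric])
    then show "(real (?n choose j) * a ^ (?n - j) * b ^ j) * G_mixed K j =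
        1 / 2 ^ ?n * (real (?n choose j) * (1 + t) ^ (?n - j) * (1 - t) ^ j * G_mixed K j)"
      by (simp add: a_def b_def power_divide)
  qed simp
  finally show ?thesis by (simp add: sum_distrib_left)
qed

theorem proposition4p3:
  fixes K :: "(real^'n) set"
  assumes "convex_body K"
  shows "(\<forall>j\<le>CARD('n). G_mixed K j =
            (\<Sum>r\<le>CARD('n) div 2. krawtchouk (2 * r) j CARD('n) * I_even K r)) \<and>
         (\<forall>r\<le>CARD('n) div 2. I_even K r =
            1 / (2 ^ CARD('n) * real (CARD('n) choose (2 * r))) *
            (\<Sum>j\<le>CARD('n). real (CARD('n) choose j) * krawtchouk (2 * r) j CARD('n) * G_mixed K j)) \<and>
         (\<forall>t\<in>{-1..1}.
            measure lebesgue (body_path K t) =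
              (\<Sum>r\<le>CARD('n) div 2. real (CARD('n) choose (2 * r)) * t ^ (2 * r) * I_even K r) \<and>
            measure lebesgue (body_path K t) =
              1 / 2 ^ CARD('n) *
              (\<Sum>j\<le>CARD('n). real (CARD('n) choose j) * (1 + t) ^ (CARD('n) - j) * (1 - t) ^ j * G_mixed K j))"
proof -
  let ?n = "CARD('n)"
  \<comment> \<open>\<open>w\<close> interpolates the quantities \<open>I_even\<close> by odd
    indices, where it vanishes, so that Krawtchouk sums can run over all \<open>k\<close>.\<close>
  define w where "w k = mixed_volume_fn (replicate (?n - k) (even_part K) @ replicate k (odd_part K))" for k
  have I: "I_even K r = w (2 * r)" for r
    by (simp add: I_even_def w_def)
  have w: "w k = (\<Sum>i\<le>?n. krawtchouk i k ?n * G_mixed K i) / 2 ^ ?n" if "k \<le> ?n" for k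
    unfolding w_def by (rule mixed_volume_fn_even_odd[OF assms that])
  have w_odd: "w k = 0" if "k \<le> ?n" "odd k" for k
    unfolding w_def by (rule mixed_volume_fn_odd_eq_0[OF assms that])
  have G: "G_mixed K j = (\<Sum>r\<le>?n div 2. krawtchouk (2 * r) j ?n * I_even K r)" if j: "j \<le> ?n" for j
  proof -
    \<comment> \<open>Inserting the expansion of \<open>w k\<close> and exchanging the sums leaves
      the Krawtchouk matrix multiplied by itself.\<close>
    have "(\<Sum>k\<le>?n. krawtchouk k j ?n * w k) =
        (\<Sum>k\<le>?n. \<Sum>i\<le>?n. krawtchouk k j ?n * krawtchouk i k ?n * G_mixed K i) / 2 ^ ?n"
      by (simp add: w sum_distrib_left sum_divide_distrib mult.assoc)
    also have "\<dots> = (\<Sum>i\<le>?n. (\<Sum>k\<le>?n. krawtchouk k j ?n * krawtchouk i k ?n) * G_mixed K i) / 2 ^ ?n"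
      unfolding sum_distrib_right by (subst sum.swap) simp
    also have "\<dots> = (\<Sum>i\<le>?n. if i = j then 2 ^ ?n * G_mixed K i else 0) / 2 ^ ?n"
      using j by (intro arg_cong2[of _ _ _ _ "(/)"] sum.cong) (auto simp: krawtchouk_orthogonal)
    also have "\<dots> = G_mixed K j"
      using j by simp
    finally show ?thesis
      using w_odd by (subst (asm) sum_atMost_even) (simp_all add: I)
  qed
  have Ieq: "I_even K r = 1 / (2 ^ ?n * real (?n choose (2 * r))) *
      (\<Sum>j\<le>?n. real (?n choose j) * krawtchouk (2 * r) j ?n * G_mixed K j)" if "r \<le> ?n div 2" for r
  proof -
    have r: "2 * r \<le> ?n" using that by linarith
    \<comment> \<open>Symmetry trades the weight \<open>n choose j\<close> for one independent of
      \<open>j\<close>; what remains is the expansion of \<open>w (2 * r)\<close>.\<close>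
    have "(\<Sum>j\<le>?n. real (?n choose j) * krawtchouk (2 * r) j ?n * G_mixed K j) =
        (\<Sum>j\<le>?n. real (?n choose (2 * r)) * krawtchouk j (2 * r) ?n * G_mixed K j)"
      using krawtchouk_symmetry[OF _ r] by (intro sum.cong) auto
    also have "\<dots> = real (?n choose (2 * r)) * (2 ^ ?n * w (2 * r))"
      unfolding w[OF r] by (simp add: sum_distrib_left[symmetric] mult.assoc)
    finally have S: "(\<Sum>j\<le>?n. real (?n choose j) * krawtchouk (2 * r) j ?n * G_mixed K j) =
        real (?n choose (2 * r)) * (2 ^ ?n * w (2 * r))" .
    have "real (?n choose (2 * r)) \<noteq> 0" using r by simp
    then show ?thesis
      unfolding I S by (simp add: field_simps)
  qed
  \<comment> \<open>A polynomial identity in \<open>t\<close>, which converts one representation of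
    the volume into the other.\<close>
  have vol: "(\<Sum>r\<le>?n div 2. real (?n choose (2 * r)) * t ^ (2 * r) * I_even K r) =
      1 / 2 ^ ?n * (\<Sum>j\<le>?n. real (?n choose j) * (1 + t) ^ (?n - j) * (1 - t) ^ j * G_mixed K j)" for t
  proof -
    have "(\<Sum>r\<le>?n div 2. real (?n choose (2 * r)) * t ^ (2 * r) * I_even K r) =
        (\<Sum>k\<le>?n. real (?n choose k) * t ^ k * w k)"
      using w_odd by (subst sum_atMost_even) (simp_all add: I)
    also have "\<dots> = 1 / 2 ^ ?n * (\<Sum>k\<le>?n. \<Sum>j\<le>?n. (real (?n choose k) * krawtchouk j k ?n) * t ^ k * G_mixed K j)"
      by (simp add: w sum_distrib_left sum_divide_distrib mult_ac)
    \<comment> \<open>After this use of symmetry the sum over \<open>k\<close> is a Krawtchouk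
      generating function in \<open>t\<close>.\<close>
    also have "(\<Sum>k\<le>?n. \<Sum>j\<le>?n. (real (?n choose k) * krawtchouk j k ?n) * t ^ k * G_mixed K j) =
        (\<Sum>k\<le>?n. \<Sum>j\<le>?n. (real (?n choose j) * krawtchouk k j ?n) * t ^ k * G_mixed K j)"
      by (intro sum.cong refl) (simp add: krawtchouk_symmetry)
    also have "\<dots> = (\<Sum>j\<le>?n. real (?n choose j) * (\<Sum>k\<le>?n. krawtchouk k j ?n * 1 ^ (?n - k) * t ^ k) * G_mixed K j)"
      by (subst sum.swap) (simp add: sum_distrib_left sum_distrib_right mult.assoc)
    also have "\<dots> = (\<Sum>j\<le>?n. real (?n choose j) * ((1 - t) ^ j * (1 + t) ^ (?n - j)) * G_mixed K j)"
      by (intro sum.cong refl) (simp only: krawtchouk_generating atMost_iff)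
    finally show ?thesis by (simp add: mult_ac)
  qed
  show ?thesis
  proof (intro conjI allI impI ballI)
    fix t :: real assume "t \<in> {-1..1}"
    then show m: "measure lebesgue (body_path K t) =
        1 / 2 ^ ?n * (\<Sum>j\<le>?n. real (?n choose j) * (1 + t) ^ (?n - j) * (1 - t) ^ j * G_mixed K j)"
      by (intro measure_body_path[OF assms]) auto
    show "measure lebesgue (body_path K t) =
        (\<Sum>r\<le>?n div 2. real (?n choose (2 * r)) * t ^ (2 * r) * I_even K r)"
      unfolding vol by (rule m)
  qed (fact G, fact Ieq)
qed

end
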